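(* Let $k$ be an integer. If $5\leq k\leq 15$, then $$c_{k}\geq\frac{1}{k-1/2}\quad\text{and}\quad c_{-k+1}\geq\frac{1}{k-1/2}.$$ If $k\geq 16$, then $$c_{k}\geq\frac{1}{4\sqrt{k-1}}\quad\text{and}\quad c_{-k+1}\geq\frac{1}{4\sqrt{k-1}}.$$
   Context: Graphs are finite, simple and undirected; the order of a graph is its number of vertices. For a graph $G$ of order $n$, $\lambda_1(G)\ge\cdots\ge\lambda_n(G)$ denote the eigenvalues of its adjacency matrix, with multiplicity. For an integer $j\ge1$, $$c_{j}=\sup\{\lambda_{j}(G)/n: G\text{ is a graph of order }n\ge j\},\qquad c_{-j}=\sup\{|\lambda_{n-j+1}(G)|/n: G\text{ is a graph of order }n\ge j\}.$$ Thus $c_{-k+1}$ means $c_{-j}$ with $j=k-1$. *)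

theory Defs
  imports
    Graph_Theory.Graph_Theory
    Jordan_Normal_Form.Char_Poly
begin

(* Finite simple undirected graphs are the library's pair_graph: a finite vertex set with a
   symmetric, irreflexive set of ordered pairs on it.  Every such graph is isomorphic to one whose
   vertices are natural numbers.  The increasing enumeration of the vertices is only a choice of
   indexing; the characteristic polynomial does not depend on it. *)

definition adjacency_matrix :: "nat pair_pre_digraph \<Rightarrow> real mat" where
  "adjacency_matrix G =
     (let vs = sorted_list_of_set (pverts G); n = card (pverts G)
      in mat n n (\<lambda>(i, j). if (vs ! i, vs ! j) \<in> parcs G then 1 else 0))"

(* All eigenvalues in non-increasing order, repeated according to multiplicity.  The adjacency
   matrix of a graph is real symmetric, so all roots of its characteristic polynomial are real and
   the list has length card (pverts G). *)

definition graph_eigenvalues :: "nat pair_pre_digraph \<Rightarrow> real list" where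
  "graph_eigenvalues G =
     rev (sorted_list_of_multiset (proots (char_poly (adjacency_matrix G))))"

(* The i-th largest eigenvalue; i counts from 1. *)

definition graph_eigenvalue :: "nat \<Rightarrow> nat pair_pre_digraph \<Rightarrow> real" where
  "graph_eigenvalue i G = graph_eigenvalues G ! (i - 1)"

(* The extremal constants for a nonzero integer index: a positive j refers to the j-th largest
   eigenvalue, a negative j to the (-j)-th smallest.  The value at 0 is meaningless.  Eigenvalues
   of a graph of order n have absolute value at most n, so these are suprema of bounded nonempty
   sets of reals. *)

definition eigenvalue_const :: "int \<Rightarrow> real" where
  "eigenvalue_const j =
     (if j > 0
      then Sup {graph_eigenvalue (nat j) G / real (card (pverts G)) | G.
                  pair_graph G \<and> card (pverts G) \<ge> nat j}
      else Sup {\<bar>graph_eigenvalue (card (pverts G) - nat (- j) + 1) G\<bar> / real (card (pverts G)) | G.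
                  pair_graph G \<and> card (pverts G) \<ge> nat (- j)})"

end

theory Submission
  imports Defs "Jordan_Normal_Form.Spectral_Radius" "HOL-Library.Countable"
begin

text \<open>
  Put a loop at every vertex of a graph of order \<open>n\<close>, so that its adjacency matrix \<open>A\<close> is a symmetric
  0/1 matrix with ones on the diagonal, and suppose that \<open>x\<^sup>T A x \<ge> \<beta> |x|\<^sup>2\<close> on a \<open>k\<close>-dimensional subspace.
  Then both \<open>c\<^sub>k\<close> and \<open>c\<close> with index \<open>-(k - 1)\<close> are at least \<open>\<beta>/n\<close>, by the Courant-Fischer principle:

  \<^item> Replacing each vertex by a clique on \<open>t\<close> vertices gives a simple graph of order \<open>tn\<close> whose \<open>k\<close>-th
    largest eigenvalue is at least \<open>t\<beta> - 1\<close>; let \<open>t\<close> tend to infinity (\<open>spectral_pattern_largest\<close>).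
  \<^item> The complement has adjacency matrix \<open>J - A\<close>, where \<open>J\<close> is the all-ones matrix. Orthogonality to the
    all-ones vector cuts the subspace down by at most one dimension and kills \<open>J\<close>, so at least \<open>k - 1\<close>
    eigenvalues of the complement are at most \<open>-\<beta>\<close> (\<open>spectral_pattern_smallest\<close>).

  It remains to find, for each \<open>k\<close>, such a triple \<open>(n, k, \<beta>)\<close> with \<open>n/\<beta>\<close> small. Both sources come from the
  lines of the grid of the cyclic group of order \<open>m\<close> (rows, columns and diagonals).

  \<^item> The \<open>3 \<times> 3\<close> rook's graph gives \<open>(9, 5, 2)\<close>. A disjoint clique on two vertices turns \<open>(n, k, 2)\<close> into
    \<open>(n + 2, k + 1, 2)\<close>, and so \<open>n/\<beta> = k - 1/2\<close> for every \<open>k \<ge> 5\<close>.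
  \<^item> Let \<open>H\<close> be a symmetric Hadamard matrix of order \<open>s\<^sup>2\<close> with ones on the diagonal. Its eigenvalues are
    \<open>s\<close> and \<open>-s\<close> and its trace is \<open>s\<^sup>2\<close>, so \<open>s\<close> has multiplicity \<open>s(s + 1)/2\<close>. Since \<open>J\<close> is positive
    semidefinite, \<open>A = (J + H)/2\<close> gives \<open>\<beta> = s/2\<close> for \<open>k = s(s + 1)/2\<close>, that is \<open>n/\<beta> = 2s\<close>. For any smaller
    \<open>k\<close> this is good enough as long as \<open>2s \<le> 4 sqrt(k - 1)\<close>, so \<open>s\<close> serves the range
    \<open>s\<^sup>2/4 + 1 \<le> k \<le> s(s + 1)/2\<close>.

  The grids of order 2 and 6 give \<open>s = 2\<close> and \<open>s = 6\<close>, and Kronecker products make the possible \<open>s\<close>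
  closed under multiplication. The ranges of \<open>6, 8, 12, 16\<close> and of \<open>24u, 32u, 36u\<close> with \<open>u\<close> a power of two
  cover all \<open>k \<ge> 16\<close> except \<open>137, ..., 144\<close>; there \<open>s = 16\<close> and at most eight additional cliques suffice.
\<close>

section \<open>Finite-dimensional linear algebra with functions as vectors\<close>

text \<open>
  Vectors and matrices of order \<open>n\<close> are functions on natural numbers of which only the values below \<open>n\<close>
  matter, so that a vector can be cut off or continued by changing \<open>n\<close> alone.
\<close>

definition inner_on :: "nat \<Rightarrow> (nat \<Rightarrow> real) \<Rightarrow> (nat \<Rightarrow> real) \<Rightarrow> real" where
  "inner_on n x y = (\<Sum>l<n. x l * y l)"

definition apply_on :: "nat \<Rightarrow> (nat \<Rightarrow> nat \<Rightarrow> real) \<Rightarrow> (nat \<Rightarrow> real) \<Rightarrow> nat \<Rightarrow> real" where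
  "apply_on n M x l = (\<Sum>m<n. M l m * x m)"

definition sym_on :: "nat \<Rightarrow> (nat \<Rightarrow> nat \<Rightarrow> real) \<Rightarrow> bool" where
  "sym_on n M \<longleftrightarrow> (\<forall>l<n. \<forall>m<n. M l m = M m l)"

definition orthonormal_on :: "nat \<Rightarrow> nat \<Rightarrow> (nat \<Rightarrow> nat \<Rightarrow> real) \<Rightarrow> bool" where
  "orthonormal_on n k v \<longleftrightarrow> (\<forall>a<k. \<forall>b<k. inner_on n (v a) (v b) = of_bool (a = b))"

definition lin_comb :: "nat \<Rightarrow> (nat \<Rightarrow> real) \<Rightarrow> (nat \<Rightarrow> nat \<Rightarrow> real) \<Rightarrow> nat \<Rightarrow> real" where
  "lin_comb k c v l = (\<Sum>a<k. c a * v a l)"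

lemma inner_on_commute: "inner_on n x y = inner_on n y x"
  by (simp add: inner_on_def mult.commute)

lemma inner_on_cong:
  "(\<And>l. l < n \<Longrightarrow> x l = x' l) \<Longrightarrow> (\<And>l. l < n \<Longrightarrow> y l = y' l) \<Longrightarrow> inner_on n x y = inner_on n x' y'"
  by (simp add: inner_on_def)

lemma inner_on_lin_comb_right: "inner_on n y (lin_comb k c v) = (\<Sum>a<k. c a * inner_on n y (v a))"
proof -
  have "inner_on n y (lin_comb k c v) = (\<Sum>l<n. \<Sum>a<k. c a * (y l * v a l))"
    by (simp add: inner_on_def lin_comb_def sum_distrib_left mult.left_commute)
  also have "\<dots> = (\<Sum>a<k. \<Sum>l<n. c a * (y l * v a l))"
    by (rule sum.swap)
  finally show ?thesis
    by (simp add: inner_on_def sum_distrib_left)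
qed

lemma inner_on_lin_comb_left: "inner_on n (lin_comb k c v) y = (\<Sum>a<k. c a * inner_on n (v a) y)"
  using inner_on_lin_comb_right[of n y k c v] by (simp add: inner_on_commute)

lemma apply_on_lin_comb: "apply_on n M (lin_comb k c v) l = (\<Sum>a<k. c a * apply_on n M (v a) l)"
  using inner_on_lin_comb_right[of n "M l" k c v] by (simp add: inner_on_def apply_on_def)

lemma inner_on_apply_on: "inner_on n x (apply_on n M y) = (\<Sum>l<n. \<Sum>m<n. M l m * x l * y m)"
  by (simp add: inner_on_def apply_on_def sum_distrib_left mult_ac)

lemma apply_on_self_adjoint:
  assumes "sym_on n M"
  shows "inner_on n x (apply_on n M y) = inner_on n (apply_on n M x) y"
proof -
  have "(\<Sum>l<n. \<Sum>m<n. M l m * x l * y m) = (\<Sum>m<n. \<Sum>l<n. M l m * x l * y m)"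
    by (rule sum.swap)
  also have "\<dots> = (\<Sum>m<n. \<Sum>l<n. M m l * y m * x l)"
    using assms by (intro sum.cong refl) (auto simp: sym_on_def mult_ac)
  finally show ?thesis
    unfolding inner_on_commute[of n "apply_on n M x"] inner_on_apply_on .
qed

lemma inner_on_self_pos: "l < n \<Longrightarrow> x l \<noteq> 0 \<Longrightarrow> 0 < inner_on n x x"
  unfolding inner_on_def by (rule sum_pos2[of _ l]) (auto simp flip: power2_eq_square)

lemma inner_on_orthonormal_lin_comb:
  assumes "orthonormal_on n k v" "b < k"
  shows "inner_on n (v b) (lin_comb k c v) = c b"
proof -
  have "inner_on n (v b) (lin_comb k c v) = (\<Sum>a<k. if b = a then c a else 0)"
    using assms unfolding inner_on_lin_comb_right orthonormal_on_def by (intro sum.cong) auto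
  also have "\<dots> = c b"
    using assms(2) by simp
  finally show ?thesis .
qed

lemma norm_orthonormal_lin_comb:
  assumes "orthonormal_on n k v"
  shows "inner_on n (lin_comb k c v) (lin_comb k c v) = (\<Sum>a<k. (c a)\<^sup>2)"
  using assms by (simp add: inner_on_lin_comb_left inner_on_orthonormal_lin_comb power2_eq_square)

text \<open>
  Pad the coefficients with zero rows to a square matrix. Its transpose annihilates a unit vector, so its
  determinant vanishes.
\<close>

lemma underdetermined_system:
  fixes a :: "nat \<Rightarrow> nat \<Rightarrow> real"
  assumes "r < k"
  shows "\<exists>c. (\<exists>j<k. c j \<noteq> 0) \<and> (\<forall>i<r. (\<Sum>j<k. a i j * c j) = 0)"
proof -
  define A where "A = mat k k (\<lambda>(i, j). if i < r then a i j else 0)"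
  have A: "A \<in> carrier_mat k k"
    by (simp add: A_def)
  \<comment> \<open>Row \<open>r\<close> of \<open>A\<close> is zero, as \<open>r < k\<close>.\<close>
  have "A\<^sup>T *\<^sub>v unit_vec k r = 0\<^sub>v k"
    using assms by (intro eq_vecI) (auto simp: A_def)
  moreover have "unit_vec k r \<noteq> (0\<^sub>v k :: real vec)"
    using assms by simp
  moreover have "unit_vec k r \<in> carrier_vec k"
    by simp
  ultimately have "det A\<^sup>T = 0"
    using A det_0_iff_vec_prod_zero_field[of "A\<^sup>T" k] by (meson transpose_carrier_mat)
  then have "det A = 0"
    using A by (simp add: det_transpose)
  then obtain v where v: "v \<in> carrier_vec k" "v \<noteq> 0\<^sub>v k" "A *\<^sub>v v = 0\<^sub>v k"
    using A det_0_iff_vec_prod_zero_field by blast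
  have "\<exists>j<k. v $ j \<noteq> 0"
    using v(1,2) by (metis carrier_vecD eq_vecI index_zero_vec)
  moreover have "(\<Sum>j<k. a i j * v $ j) = 0" if "i < r" for i
  proof -
    have "(A *\<^sub>v v) $ i = (\<Sum>j<k. a i j * v $ j)"
      using that assms v(1) by (simp add: A_def scalar_prod_def atLeast0LessThan)
    then show ?thesis
      using v(3) that assms by simp
  qed
  ultimately show ?thesis by blast
qed

lemma orthonormal_le:
  assumes "orthonormal_on n k v"
  shows "k \<le> n"
proof (rule ccontr)
  assume "\<not> k \<le> n"
  then obtain c j where c: "j < k" "c j \<noteq> 0" "\<And>l. l < n \<Longrightarrow> (\<Sum>a<k. v a l * c a) = 0"
    using underdetermined_system[of n k "\<lambda>l a. v a l"] by auto
  have "c j = inner_on n (v j) (lin_comb k c v)"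
    using inner_on_orthonormal_lin_comb[OF assms c(1)] by simp
  also have "\<dots> = 0"
    using c(3) by (simp add: inner_on_def lin_comb_def mult.commute)
  finally show False
    using c(2) by simp
qed

text \<open>
  The Gram-Schmidt step in the case where the new vector is already orthogonal to the old ones.
\<close>

lemma orthonormal_snoc:
  assumes v: "orthonormal_on n m v" and y: "l < n" "y l \<noteq> 0"
    and perp: "\<And>a. a < m \<Longrightarrow> inner_on n (v a) y = 0"
  shows "orthonormal_on n (Suc m) (v(m := \<lambda>l. y l / sqrt (inner_on n y y)))"
proof -
  let ?s = "sqrt (inner_on n y y)"
  have s: "0 < inner_on n y y"
    using inner_on_self_pos[of l n y] y by simp
  have "inner_on n (v a) (\<lambda>l. y l / ?s) = 0" if "a < m" for a
    using perp[OF that] by (simp add: inner_on_def flip: sum_divide_distrib)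
  moreover have "inner_on n (\<lambda>l. y l / ?s) (\<lambda>l. y l / ?s) = 1"
  proof -
    have "inner_on n (\<lambda>l. y l / ?s) (\<lambda>l. y l / ?s) = inner_on n y y / (?s * ?s)"
      by (simp add: inner_on_def sum_divide_distrib)
    then show ?thesis using s by simp
  qed
  ultimately show ?thesis
    using v by (auto simp: orthonormal_on_def less_Suc_eq inner_on_commute)
qed

lemma orthonormal_extend:
  assumes "orthonormal_on n m v" "m \<le> n"
  shows "\<exists>w. orthonormal_on n n w \<and> (\<forall>a<m. w a = v a)"
  using assms(2,1)
proof (induction m arbitrary: v rule: inc_induct)
  case base
  then show ?case by blast
next
  case (step m)
  obtain y l where "l < n" "y l \<noteq> 0" "\<And>a. a < m \<Longrightarrow> inner_on n (v a) y = 0"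
    using underdetermined_system[of m n v] step.hyps by (auto simp: inner_on_def)
  from orthonormal_snoc[OF step.prems this] step.IH
  obtain w where "orthonormal_on n n w"
    "\<forall>a<Suc m. w a = (v(m := \<lambda>l. y l / sqrt (inner_on n y y))) a"
    by blast
  then show ?case
    by (intro exI[of _ w]) auto
qed

text \<open>
  A full orthonormal family is a basis: a nonzero remainder of the expansion would be orthogonal to the
  whole family and extend it to \<open>n + 1\<close> orthonormal vectors.
\<close>

lemma orthonormal_expansion:
  assumes "orthonormal_on n n w" "l < n"
  shows "x l = lin_comb n (\<lambda>a. inner_on n (w a) x) w l"
proof (rule ccontr)
  let ?p = "lin_comb n (\<lambda>a. inner_on n (w a) x) w"
  assume "x l \<noteq> ?p l"
  moreover have "inner_on n (w a) (\<lambda>l. x l - ?p l) = 0" if "a < n" for a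
  proof -
    have "inner_on n (w a) (\<lambda>l. x l - ?p l) = inner_on n (w a) x - inner_on n (w a) ?p"
      by (simp add: inner_on_def sum_subtractf right_diff_distrib)
    then show ?thesis
      using inner_on_orthonormal_lin_comb[OF assms(1) that] by simp
  qed
  ultimately have "\<exists>w. orthonormal_on n (Suc n) w"
    using orthonormal_snoc[OF assms, of "\<lambda>l. x l - ?p l"] by auto
  then show False
    using orthonormal_le by fastforce
qed

lemma inner_on_expansion:
  assumes "orthonormal_on n n w"
  shows "inner_on n y x = (\<Sum>a<n. inner_on n (w a) x * inner_on n y (w a))"
proof -
  have "inner_on n y x = inner_on n y (lin_comb n (\<lambda>a. inner_on n (w a) x) w)"
    using orthonormal_expansion[OF assms] by (intro inner_on_cong) auto
  then show ?thesis by (simp add: inner_on_lin_comb_right)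
qed

section \<open>Diagonalisation of real symmetric matrices\<close>

definition eigenbasis_on ::
    "nat \<Rightarrow> (nat \<Rightarrow> nat \<Rightarrow> real) \<Rightarrow> (nat \<Rightarrow> real) \<Rightarrow> (nat \<Rightarrow> nat \<Rightarrow> real) \<Rightarrow> bool" where
  "eigenbasis_on n M d u \<longleftrightarrow>
     orthonormal_on n n u \<and> (\<forall>i<n. \<forall>l<n. apply_on n M (u i) l = d i * u i l)"

text \<open>
  The complexified matrix has some eigenvalue \<open>z\<close> with an eigenvector \<open>f\<close>. As the matrix is real and
  symmetric, the Hermitian form \<open>f\<^sup>* M f = z |f|\<^sup>2\<close> is its own conjugate, so \<open>z\<close> is real. It is therefore a
  root of the real characteristic polynomial and has a real eigenvector.
\<close>

lemma symmetric_real_eigenvector: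
  assumes sym: "sym_on n M" and "0 < n"
  shows "\<exists>e x. (\<exists>l<n. x l \<noteq> 0) \<and> (\<forall>l<n. apply_on n M x l = e * x l)"
proof -
  define A where "A = mat n n (\<lambda>(i, j). M i j)"
  have A: "A \<in> carrier_mat n n"
    by (simp add: A_def)
  define C where "C = map_mat complex_of_real A"
  have C: "C \<in> carrier_mat n n"
    using A by (simp add: C_def)
  obtain z where "eigenvalue C z"
    using spectrum_non_empty[OF C \<open>0 < n\<close>] by (auto simp: spectrum_def)
  then obtain v where v: "v \<in> carrier_vec n" "v \<noteq> 0\<^sub>v n" "C *\<^sub>v v = z \<cdot>\<^sub>v v"
    using C by (auto simp: eigenvalue_def eigenvector_def)
  define f where "f i = v $ i" for i
  have eig: "(\<Sum>j<n. of_real (M i j) * f j) = z * f i" if "i < n" for i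
  proof -
    have "(C *\<^sub>v v) $ i = (\<Sum>j<n. of_real (M i j) * f j)"
      using that v(1) by (simp add: C_def A_def f_def scalar_prod_def atLeast0LessThan)
    then show ?thesis
      using v that by (simp add: f_def)
  qed
  obtain i0 where i0: "i0 < n" "f i0 \<noteq> 0"
    unfolding f_def using v(1,2) by (metis carrier_vecD eq_vecI index_zero_vec)
  define q where "q = (\<Sum>i<n. \<Sum>j<n. of_real (M i j) * f j * cnj (f i))"
  define N where "N = (\<Sum>i<n. (cmod (f i))\<^sup>2)"
  have "q = (\<Sum>i<n. z * f i * cnj (f i))"
    unfolding q_def by (intro sum.cong refl) (simp add: eig flip: sum_distrib_right)
  also have "\<dots> = z * of_real N"
    unfolding N_def of_real_sum sum_distrib_left complex_norm_square by (simp add: mult.assoc)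
  finally have qN: "q = z * of_real N" .
  have "cnj q = (\<Sum>i<n. \<Sum>j<n. of_real (M i j) * cnj (f j) * f i)"
    by (simp add: q_def)
  also have "\<dots> = (\<Sum>j<n. \<Sum>i<n. of_real (M i j) * cnj (f j) * f i)"
    by (rule sum.swap)
  also have "\<dots> = q"
    unfolding q_def using sym by (intro sum.cong refl) (auto simp: sym_on_def mult_ac)
  finally have "cnj z * of_real N = z * of_real N"
    unfolding qN by simp
  moreover have "0 < N"
    unfolding N_def using i0 by (intro sum_pos2[of _ i0]) auto
  ultimately have "cnj z = z"
    by simp
  then have z: "z = of_real (Re z)"
    by (simp add: complex_eq_iff)
  have "poly (char_poly C) z = 0"
    using \<open>eigenvalue C z\<close> eigenvalue_root_char_poly[OF C] by blast
  then have "poly (map_poly of_real (char_poly A)) (complex_of_real (Re z)) = 0"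
    unfolding C_def of_real_hom.char_poly_hom[OF A] using z by simp
  then have "poly (char_poly A) (Re z) = 0"
    by simp
  then have "eigenvalue A (Re z)"
    using eigenvalue_root_char_poly[OF A] by blast
  then obtain w where w: "w \<in> carrier_vec n" "w \<noteq> 0\<^sub>v n" "A *\<^sub>v w = Re z \<cdot>\<^sub>v w"
    using A by (auto simp: eigenvalue_def eigenvector_def)
  have "apply_on n M (\<lambda>i. w $ i) l = Re z * w $ l" if "l < n" for l
  proof -
    have "(A *\<^sub>v w) $ l = apply_on n M (\<lambda>i. w $ i) l"
      using that w(1) by (simp add: apply_on_def A_def scalar_prod_def atLeast0LessThan)
    then show ?thesis
      using w that by simp
  qed
  moreover have "\<exists>l<n. w $ l \<noteq> 0"
    using w(1,2) by (metis carrier_vecD eq_vecI index_zero_vec)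
  ultimately show ?thesis by blast
qed

text \<open>
  The orthogonal complement of a family of eigenvectors is invariant under \<open>M\<close>. In an orthonormal basis \<open>w'\<close>
  of the complement, \<open>M\<close> acts there by a symmetric matrix \<open>N\<close> of order \<open>n - m\<close>, and an eigenvector of \<open>N\<close>
  lists the coordinates of a further eigenvector of \<open>M\<close>.
\<close>

lemma extend_eigenfamily:
  assumes sym: "sym_on n M" and "m < n" and u: "orthonormal_on n m u"
    and eig: "\<And>i l. i < m \<Longrightarrow> l < n \<Longrightarrow> apply_on n M (u i) l = d i * u i l"
  shows "\<exists>y e. (\<exists>l<n. y l \<noteq> 0) \<and> (\<forall>i<m. inner_on n (u i) y = 0)
    \<and> (\<forall>l<n. apply_on n M y l = e * y l)"
proof -
  obtain w where w: "orthonormal_on n n w" and wu: "\<And>a. a < m \<Longrightarrow> w a = u a"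
    using orthonormal_extend[OF u] \<open>m < n\<close> by auto
  define w' where "w' a = w (m + a)" for a
  have w': "orthonormal_on n (n - m) w'"
    using w by (simp add: orthonormal_on_def w'_def)
  define N where "N i j = inner_on n (w' i) (apply_on n M (w' j))" for i j
  have "sym_on (n - m) N"
    unfolding sym_on_def N_def 
    by (intro allI impI, subst apply_on_self_adjoint[OF sym], rule inner_on_commute)
  then obtain e c j where c: "j < n - m" "c j \<noteq> 0"
    "\<And>i. i < n - m \<Longrightarrow> apply_on (n - m) N c i = e * c i"
    using symmetric_real_eigenvector[of "n - m" N] \<open>m < n\<close> by auto
  define y where "y = lin_comb (n - m) c w'"
  have wy: "inner_on n (w' i) y = c i" if "i < n - m" for i
    unfolding y_def using inner_on_orthonormal_lin_comb[OF w' that] .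
  have uy: "inner_on n (u i) y = 0" if "i < m" for i
  proof -
    have "inner_on n (u i) (w' a) = 0" if "a < n - m" for a
    proof -
      have "inner_on n (w i) (w (m + a)) = of_bool (i = m + a)"
        using w that \<open>i < m\<close> unfolding orthonormal_on_def by simp
      then show ?thesis
        using \<open>i < m\<close> by (simp add: w'_def wu)
    qed
    then show ?thesis
      by (simp add: y_def inner_on_lin_comb_right)
  qed
  have My: "inner_on n (w a) (apply_on n M y) = inner_on n (w a) (\<lambda>l. e * y l)" if "a < n" for a
  proof (cases "a < m")
    case True
    have "inner_on n (u a) (apply_on n M y) = inner_on n (\<lambda>l. d a * u a l) y"
      unfolding apply_on_self_adjoint[OF sym] using eig[OF True] by (intro inner_on_cong) auto
    also have "\<dots> = d a * inner_on n (u a) y"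
      by (simp add: inner_on_def sum_distrib_left mult.assoc)
    finally have "inner_on n (u a) (apply_on n M y) = 0"
      using uy[OF True] by simp
    moreover have "inner_on n (u a) (\<lambda>l. e * y l) = e * inner_on n (u a) y"
      by (simp add: inner_on_def sum_distrib_left mult.left_commute)
    ultimately show ?thesis
      using uy[OF True] wu[OF True] by simp
  next
    case False
    define b where "b = a - m"
    have b: "b < n - m" "w a = w' b"
      using False that by (auto simp: b_def w'_def)
    have "inner_on n (w' b) (apply_on n M y) = inner_on n (apply_on n M (w' b)) y"
      by (rule apply_on_self_adjoint[OF sym])
    also have "\<dots> = (\<Sum>j<n - m. c j * inner_on n (apply_on n M (w' b)) (w' j))"
      unfolding y_def by (rule inner_on_lin_comb_right)
    also have "\<dots> = apply_on (n - m) N c b"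
      unfolding N_def apply_on_self_adjoint[OF sym, of "w' b"] apply_on_def[of "n - m"]
      by (simp add: mult.commute)
    also have "\<dots> = e * inner_on n (w' b) y"
      using c(3)[OF b(1)] wy[OF b(1)] by simp
    also have "\<dots> = inner_on n (w' b) (\<lambda>l. e * y l)"
      by (simp add: inner_on_def sum_distrib_left mult.left_commute)
    finally show ?thesis
      unfolding b(2) .
  qed
  have "apply_on n M y l = e * y l" if "l < n" for l
  proof -
    have "apply_on n M y l = lin_comb n (\<lambda>a. inner_on n (w a) (apply_on n M y)) w l"
      by (rule orthonormal_expansion[OF w that])
    also have "\<dots> = lin_comb n (\<lambda>a. inner_on n (w a) (\<lambda>l. e * y l)) w l"
      by (simp add: lin_comb_def My)
    also have "\<dots> = e * y l"
      using orthonormal_expansion[OF w that, of "\<lambda>l. e * y l"] by simp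
    finally show ?thesis .
  qed
  moreover have "\<exists>l<n. y l \<noteq> 0"
  proof (rule ccontr)
    assume "\<not> (\<exists>l<n. y l \<noteq> 0)"
    then have "inner_on n (w' j) y = 0"
      by (simp add: inner_on_def)
    then show False
      using wy[OF c(1)] c(2) by simp
  qed
  ultimately show ?thesis
    using uy by blast
qed

theorem spectral_theorem:
  assumes sym: "sym_on n M"
  shows "\<exists>d u. eigenbasis_on n M d u"
proof -
  have "\<exists>d u. orthonormal_on n m u \<and> (\<forall>i<m. \<forall>l<n. apply_on n M (u i) l = d i * u i l)"
    if "m \<le> n" for m
    using that
  proof (induction m)
    case 0
    then show ?case by (simp add: orthonormal_on_def)
  next
    case (Suc m)
    then obtain d u where u: "orthonormal_on n m u"
      and eig: "\<And>i l. i < m \<Longrightarrow> l < n \<Longrightarrow> apply_on n M (u i) l = d i * u i l"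
      by auto
    obtain y e l where y: "l < n" "y l \<noteq> 0" "\<And>i. i < m \<Longrightarrow> inner_on n (u i) y = 0"
      and ey: "\<And>l. l < n \<Longrightarrow> apply_on n M y l = e * y l"
      using extend_eigenfamily[OF sym _ u eig] Suc.prems by (metis Suc_le_lessD)
    let ?y = "\<lambda>l. y l / sqrt (inner_on n y y)"
    have "apply_on n M ?y l = e * ?y l" if "l < n" for l
      using ey[OF that] by (simp add: apply_on_def flip: sum_divide_distrib)
    then have "\<forall>i<Suc m. \<forall>l<n. apply_on n M ((u(m := ?y)) i) l = (d(m := e)) i * (u(m := ?y)) i l"
      using eig by (auto simp: less_Suc_eq)
    then show ?case
      using orthonormal_snoc[OF u y] by blast
  qed
  then show ?thesis
    unfolding eigenbasis_on_def by blast
qed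

lemma eigenbasis_coordinates:
  assumes "eigenbasis_on n M d u" "sym_on n M" "i < n"
  shows "inner_on n (u i) (apply_on n M x) = d i * inner_on n (u i) x"
proof -
  have "inner_on n (u i) (apply_on n M x) = inner_on n (\<lambda>l. d i * u i l) x"
    unfolding apply_on_self_adjoint[OF assms(2)] using assms
    by (intro inner_on_cong) (auto simp: eigenbasis_on_def)
  then show ?thesis
    by (simp add: inner_on_def sum_distrib_left mult.assoc)
qed

lemma quadratic_form_eigenbasis:
  assumes "eigenbasis_on n M d u" "sym_on n M"
  shows "inner_on n x (apply_on n M x) = (\<Sum>i<n. d i * (inner_on n (u i) x)\<^sup>2)"
proof -
  have "orthonormal_on n n u"
    using assms by (simp add: eigenbasis_on_def)
  then have "inner_on n x (apply_on n M x)
      = (\<Sum>i<n. inner_on n (u i) (apply_on n M x) * inner_on n x (u i))"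
    by (rule inner_on_expansion)
  also have "\<dots> = (\<Sum>i<n. d i * (inner_on n (u i) x)\<^sup>2)"
    using eigenbasis_coordinates[OF assms]
    by (intro sum.cong) (auto simp: inner_on_commute[of n x] power2_eq_square)
  finally show ?thesis .
qed

text \<open>
  The rows of a square matrix are orthonormal as soon as its columns are.
\<close>

lemma completeness_eigenbasis:
  assumes "orthonormal_on n n u" "l < n" "m < n"
  shows "(\<Sum>i<n. u i l * u i m) = of_bool (l = m)"
proof -
  have "inner_on n (u i) (\<lambda>j. of_bool (j = m)) = u i m" for i
  proof -
    have "inner_on n (u i) (\<lambda>j. of_bool (j = m)) = (\<Sum>l<n. if l = m then u i l else 0)"
      unfolding inner_on_def by (intro sum.cong) auto
    then show ?thesis
      using assms(3) by simp
  qed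
  then show ?thesis
    using orthonormal_expansion[OF assms(1,2), of "\<lambda>j. of_bool (j = m)"]
    by (simp add: lin_comb_def mult.commute)
qed

lemma trace_eigenbasis:
  assumes "eigenbasis_on n M d u"
  shows "(\<Sum>l<n. M l l) = (\<Sum>i<n. d i)"
proof -
  have u: "orthonormal_on n n u"
    using assms by (simp add: eigenbasis_on_def)
  have "M l l = (\<Sum>i<n. d i * (u i l)\<^sup>2)" if "l < n" for l
  proof -
    have "(\<Sum>i<n. d i * (u i l)\<^sup>2) = (\<Sum>i<n. apply_on n M (u i) l * u i l)"
      using assms that by (simp add: eigenbasis_on_def power2_eq_square mult.assoc)
    also have "\<dots> = (\<Sum>i<n. \<Sum>m<n. M l m * (u i m * u i l))"
      by (simp add: apply_on_def sum_distrib_right mult.assoc)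
    also have "\<dots> = (\<Sum>m<n. \<Sum>i<n. M l m * (u i m * u i l))"
      by (rule sum.swap)
    also have "\<dots> = (\<Sum>m<n. if l = m then M l m else 0)"
      using completeness_eigenbasis[OF u _ that]
      by (intro sum.cong) (auto simp flip: sum_distrib_left)
    also have "\<dots> = M l l"
      using that by simp
    finally show ?thesis ..
  qed
  then have "(\<Sum>l<n. M l l) = (\<Sum>l<n. \<Sum>i<n. d i * (u i l)\<^sup>2)"
    by simp
  also have "\<dots> = (\<Sum>i<n. \<Sum>l<n. d i * (u i l)\<^sup>2)"
    by (rule sum.swap)
  also have "\<dots> = (\<Sum>i<n. d i)"
    using u by (intro sum.cong)
      (auto simp: orthonormal_on_def inner_on_def power2_eq_square simp flip: sum_distrib_left)
  finally show ?thesis .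
qed

text \<open>
  The matrix \<open>U\<close> with the eigenvectors as columns is orthogonal and conjugates \<open>M\<close> to a diagonal matrix.
\<close>

lemma char_poly_eigenbasis:
  assumes "eigenbasis_on n M d u"
  shows "proots (char_poly (mat n n (\<lambda>(i, j). M i j))) = image_mset d (mset_set {..<n})"
proof -
  let ?A = "mat n n (\<lambda>(i, j). M i j)" and ?D = "mat n n (\<lambda>(i, j). if i = j then d i else 0)"
  let ?U = "mat n n (\<lambda>(l, i). u i l)"
  have u: "orthonormal_on n n u"
    using assms by (simp add: eigenbasis_on_def)
  have ut: "?U\<^sup>T * ?U = 1\<^sub>m n"
    using u by (intro eq_matI)
      (auto simp: scalar_prod_def orthonormal_on_def inner_on_def atLeast0LessThan)
  have tu: "?U * ?U\<^sup>T = 1\<^sub>m n"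
    using mat_mult_left_right_inverse[OF _ _ ut] by simp
  have "?A * ?U = ?U * ?D"
  proof (intro eq_matI)
    fix l i assume "l < dim_row (?U * ?D)" "i < dim_col (?U * ?D)"
    then have li: "l < n" "i < n" by simp_all
    have "(?A * ?U) $$ (l, i) = apply_on n M (u i) l"
      using li by (simp add: scalar_prod_def apply_on_def atLeast0LessThan)
    also have "\<dots> = d i * u i l"
      using assms li by (simp add: eigenbasis_on_def)
    also have "\<dots> = (\<Sum>j<n. if j = i then u j l * d j else 0)"
      using li by simp
    also have "\<dots> = (?U * ?D) $$ (l, i)"
      using li by (simp add: scalar_prod_def atLeast0LessThan if_distrib[of "\<lambda>x. _ * x"] cong: if_cong)
    finally show "(?A * ?U) $$ (l, i) = (?U * ?D) $$ (l, i)" .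
  qed auto
  then have "?U * ?D * ?U\<^sup>T = ?A * ?U * ?U\<^sup>T"
    by simp
  also have "\<dots> = ?A * (?U * ?U\<^sup>T)"
    by (rule assoc_mult_mat[of _ n n _ n _ n]) auto
  also have "\<dots> = ?A"
    unfolding tu by (rule right_mult_one_mat[of _ n]) auto
  finally have "similar_mat ?A ?D"
    using ut tu by (intro similar_matI[of _ _ ?U "?U\<^sup>T" n]) auto
  then have "char_poly ?A = char_poly ?D"
    by (rule char_poly_similar)
  also have "\<dots> = (\<Prod>a\<leftarrow>diag_mat ?D. [:- a, 1:])"
    by (rule char_poly_upper_triangular[of _ n]) auto
  also have "diag_mat ?D = map d [0..<n]"
    by (auto simp: diag_mat_def)
  also have "(\<Prod>a\<leftarrow>map d [0..<n]. [:- a, 1:]) = (\<Prod>i\<in>{..<n}. [:- d i, 1:])"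
    by (induction n) (auto simp: mult.commute)
  also have "proots \<dots> = (\<Sum>i<n. {#d i#})"
    by (subst proots_prod) auto
  also have "\<dots> = image_mset d (mset_set {..<n})"
    by (induction n) (auto simp: lessThan_Suc)
  finally show ?thesis .
qed

section \<open>Counting eigenvalues by quadratic forms\<close>

text \<open>
  This is the inequality of the Courant-Fischer principle for a subspace with an orthonormal basis \<open>v\<close>, of
  which only the vectors orthogonal to \<open>r\<close> given vectors \<open>w\<close> are tested. If the conclusion failed, the
  eigenvectors for eigenvalues \<open>\<ge> \<beta>\<close> together with \<open>w\<close> would impose fewer than \<open>k\<close> linear conditions on the
  \<open>k\<close> coefficients. A nonzero solution is a vector \<open>x\<close> whose quadratic form involves only eigenvalues
  below \<open>\<beta>\<close> but is at least \<open>\<beta> |x|\<^sup>2\<close>.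
\<close>

lemma eigenvalues_at_least:
  assumes eb: "eigenbasis_on n M d u" and sym: "sym_on n M" and v: "orthonormal_on n k v"
    and form: "\<And>c. (\<And>i. i < r \<Longrightarrow> inner_on n (w i) (lin_comb k c v) = 0) \<Longrightarrow>
      \<beta> * (\<Sum>a<k. (c a)\<^sup>2) \<le> inner_on n (lin_comb k c v) (apply_on n M (lin_comb k c v))"
  shows "k \<le> card {i. i < n \<and> \<beta> \<le> d i} + r"
proof (rule ccontr)
  define S where "S = {i. i < n \<and> \<beta> \<le> d i}"
  define xs where "xs = sorted_list_of_set S"
  have xs: "set xs = S" "length xs = card S"
    by (simp_all add: xs_def S_def)
  assume "\<not> ?thesis"
  then have "card S + r < k"
    by (simp add: S_def)
  then obtain c j where c: "j < k" "c j \<noteq> 0" and zero: "\<And>i. i < card S + r \<Longrightarrow>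
      (\<Sum>a<k. inner_on n (if i < card S then u (xs ! i) else w (i - card S)) (v a) * c a) = 0"
    using underdetermined_system[of "card S + r" k
        "\<lambda>i a. inner_on n (if i < card S then u (xs ! i) else w (i - card S)) (v a)"] by auto
  define x where "x = lin_comb k c v"
  have ux: "inner_on n (u i) x = 0" if "i \<in> S" for i
  proof -
    have "i \<in> set xs"
      using that xs(1) by simp
    then obtain p where "p < card S" "i = xs ! p"
      unfolding in_set_conv_nth xs(2) by blast
    have "(\<Sum>a<k. inner_on n (u (xs ! p)) (v a) * c a) = 0"
      using zero[of p] \<open>p < card S\<close> by simp
    then show ?thesis
      unfolding x_def inner_on_lin_comb_right \<open>i = xs ! p\<close> by (simp only: mult.commute)
  qed
  have wx: "inner_on n (w i) x = 0" if "i < r" for i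
  proof -
    have "(\<Sum>a<k. inner_on n (w i) (v a) * c a) = 0"
      using zero[of "card S + i"] that by simp
    then show ?thesis
      unfolding x_def inner_on_lin_comb_right by (simp only: mult.commute)
  qed
  have orth: "orthonormal_on n n u"
    using eb by (simp add: eigenbasis_on_def)
  have norm: "inner_on n x x = (\<Sum>a<k. (c a)\<^sup>2)"
    unfolding x_def by (rule norm_orthonormal_lin_comb[OF v])
  have normu: "inner_on n x x = (\<Sum>i<n. (inner_on n (u i) x)\<^sup>2)"
    unfolding inner_on_expansion[OF orth, of x x]
    by (simp add: inner_on_commute[of n x] power2_eq_square)
  have "\<beta> * inner_on n x x \<le> inner_on n x (apply_on n M x)"
    using form[of c] wx unfolding norm by (simp add: x_def)
  then have "(\<Sum>i<n. (\<beta> - d i) * (inner_on n (u i) x)\<^sup>2) \<le> 0"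
    unfolding quadratic_form_eigenbasis[OF eb sym] normu
    by (simp add: sum_distrib_left left_diff_distrib sum_subtractf)
  moreover have nonneg: "0 \<le> (\<beta> - d i) * (inner_on n (u i) x)\<^sup>2" if "i < n" for i
    using ux[of i] that by (cases "i \<in> S") (auto simp: S_def)
  ultimately have "(\<Sum>i<n. (\<beta> - d i) * (inner_on n (u i) x)\<^sup>2) = 0"
    by (intro antisym sum_nonneg) auto
  then have "(\<beta> - d i) * (inner_on n (u i) x)\<^sup>2 = 0" if "i < n" for i
    using nonneg that by (subst (asm) sum_nonneg_eq_0_iff) auto
  then have "inner_on n (u i) x = 0" if "i < n" for i
    using ux[of i] that by (cases "i \<in> S") (auto simp: S_def)
  then have "(\<Sum>a<k. (c a)\<^sup>2) = 0"
    using norm normu by simp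
  then show False
    using c by (simp add: sum_nonneg_eq_0_iff)
qed

lemma eigenvalues_at_most:
  assumes eb: "eigenbasis_on n M d u" and sym: "sym_on n M" and v: "orthonormal_on n k v"
    and form: "\<And>c. (\<And>i. i < r \<Longrightarrow> inner_on n (w i) (lin_comb k c v) = 0) \<Longrightarrow>
      inner_on n (lin_comb k c v) (apply_on n M (lin_comb k c v)) \<le> - \<beta> * (\<Sum>a<k. (c a)\<^sup>2)"
  shows "k \<le> card {i. i < n \<and> d i \<le> - \<beta>} + r"
proof -
  have neg: "apply_on n (\<lambda>l m. - M l m) x l = - apply_on n M x l" for x l
    by (simp add: apply_on_def sum_negf)
  have neg': "inner_on n x (apply_on n (\<lambda>l m. - M l m) y) = - inner_on n x (apply_on n M y)" for x y
    by (simp add: inner_on_def neg sum_negf)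
  have "eigenbasis_on n (\<lambda>l m. - M l m) (\<lambda>i. - d i) u"
    using eb by (simp add: eigenbasis_on_def neg)
  moreover have "sym_on n (\<lambda>l m. - M l m)"
    using sym by (simp add: sym_on_def)
  ultimately have "k \<le> card {i. i < n \<and> \<beta> \<le> - d i} + r"
    using v by (rule eigenvalues_at_least) (use form in \<open>fastforce simp: neg'\<close>)
  then show ?thesis
    by (simp add: le_minus_iff)
qed

lemma sorted_nth_ge:
  fixes L :: "real list"
  assumes "sorted L" "1 \<le> j" "j \<le> length (filter (\<lambda>x. \<beta> \<le> x) L)"
  shows "\<beta> \<le> L ! (length L - j)"
proof (rule ccontr)
  have "length (filter (\<lambda>x. \<beta> \<le> x) L) \<le> length L" by simp
  with assms have j: "j \<le> length L" by linarith
  assume "\<not> ?thesis"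
  then have "L ! i < \<beta>" if "i \<le> length L - j" for i
  proof -
    have "length L - j < length L"
      using assms(2) j by linarith
    from sorted_nth_mono[OF assms(1) that this] show ?thesis
      using \<open>\<not> \<beta> \<le> L ! (length L - j)\<close> by linarith
  qed
  then have "{i. i < length L \<and> \<beta> \<le> L ! i} \<subseteq> {length L - j<..<length L}"
    by (auto simp: not_le[symmetric])
  then have "card {i. i < length L \<and> \<beta> \<le> L ! i} \<le> card {length L - j<..<length L}"
    by (intro card_mono) auto
  then show False
    using assms j by (simp add: length_filter_conv_card)
qed

lemma sorted_nth_le:
  fixes L :: "real list"
  assumes "sorted L" "1 \<le> j" "j \<le> length (filter (\<lambda>x. x \<le> \<beta>) L)"
  shows "L ! (j - 1) \<le> \<beta>"
proof (rule ccontr)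
  assume *: "\<not> ?thesis"
  have "\<beta> < L ! i" if "j - 1 \<le> i" "i < length L" for i
    using sorted_nth_mono[OF assms(1) that] * by simp
  then have "{i. i < length L \<and> L ! i \<le> \<beta>} \<subseteq> {..<j - 1}"
    by (auto simp: not_le[symmetric])
  then have "card {i. i < length L \<and> L ! i \<le> \<beta>} \<le> card {..<j - 1}"
    by (intro card_mono) auto
  then show False
    using assms by (simp add: length_filter_conv_card)
qed

section \<open>The extremal constants as suprema over graphs\<close>

text \<open>
  The entries of the adjacency matrix in the indexing that the matrix itself uses, extended to all pairs of
  natural numbers.
\<close>

definition adjacency_function :: "nat pair_pre_digraph \<Rightarrow> nat \<Rightarrow> nat \<Rightarrow> real" where
  "adjacency_function G i j =
     of_bool ((sorted_list_of_set (pverts G) ! i, sorted_list_of_set (pverts G) ! j) \<in> parcs G)"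

lemma length_filter_sorted_list_image:
  fixes n :: nat
  shows
  "length (filter P (sorted_list_of_multiset (image_mset d (mset_set {..<n})))) = card {i. i < n \<and> P (d i)}"
proof -
  have "length (filter P (sorted_list_of_multiset (image_mset d (mset_set {..<n}))))
      = size (filter_mset P (image_mset d (mset_set {..<n})))"
    by (metis mset_filter mset_sorted_list_of_multiset size_mset)
  also have "\<dots> = card {i. i < n \<and> P (d i)}"
    by (simp add: filter_mset_image_mset)
  finally show ?thesis .
qed

lemma adjacency_eigenbasis:
  assumes "pair_graph G"
  obtains d u where "sym_on (card (pverts G)) (adjacency_function G)"
    "eigenbasis_on (card (pverts G)) (adjacency_function G) d u"
    "graph_eigenvalues G = rev (sorted_list_of_multiset (image_mset d (mset_set {..<card (pverts G)})))"
proof -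
  interpret pair_graph G by fact
  let ?n = "card (pverts G)"
  have "symmetric G"
    by (rule pair_sym_arcs)
  then have "(x, y) \<in> parcs G \<longleftrightarrow> (y, x) \<in> parcs G" for x y
    by (auto simp: symmetric_def sym_def arcs_ends_def arc_to_ends_def image_iff)
  then have sym: "sym_on ?n (adjacency_function G)"
    by (simp add: sym_on_def adjacency_function_def)
  obtain d u where eb: "eigenbasis_on ?n (adjacency_function G) d u"
    using spectral_theorem[OF sym] by blast
  have "adjacency_matrix G = mat ?n ?n (\<lambda>(i, j). adjacency_function G i j)"
    by (auto simp: adjacency_matrix_def adjacency_function_def Let_def)
  then have "graph_eigenvalues G = rev (sorted_list_of_multiset (image_mset d (mset_set {..<?n})))"
    by (simp add: graph_eigenvalues_def char_poly_eigenbasis[OF eb])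
  with sym eb that show thesis by blast
qed

text \<open>
  With a unit eigenvector \<open>u\<close> the eigenvalue is \<open>u\<^sup>T M u\<close>. The entries of \<open>M\<close> lie between 0 and 1, so the
  estimate \<open>2 |u\<^sub>l u\<^sub>m| \<le> u\<^sub>l\<^sup>2 + u\<^sub>m\<^sup>2\<close> bounds it by \<open>n |u|\<^sup>2\<close>. The bound makes the suprema in the definition of
  the constants suprema of bounded sets.
\<close>

lemma abs_graph_eigenvalue_le:
  assumes G: "pair_graph G" and i: "1 \<le> i" "i \<le> card (pverts G)"
  shows "\<bar>graph_eigenvalue i G\<bar> \<le> card (pverts G)"
proof -
  let ?n = "card (pverts G)" and ?M = "adjacency_function G"
  obtain d u where sym: "sym_on ?n ?M" and eb: "eigenbasis_on ?n ?M d u"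
    and ev: "graph_eigenvalues G = rev (sorted_list_of_multiset (image_mset d (mset_set {..<?n})))"
    using adjacency_eigenbasis[OF G] .
  have "length (graph_eigenvalues G) = ?n"
    unfolding ev by (metis length_rev mset_sorted_list_of_multiset size_mset size_image_mset
        size_mset_set card_lessThan)
  then have "graph_eigenvalue i G \<in> set (graph_eigenvalues G)"
    using i unfolding graph_eigenvalue_def by (intro nth_mem) simp
  then obtain p where p: "p < ?n" "graph_eigenvalue i G = d p"
    unfolding ev by auto
  have one: "(\<Sum>l<?n. (u p l)\<^sup>2) = 1"
    using eb p(1) by (simp add: eigenbasis_on_def orthonormal_on_def inner_on_def power2_eq_square)
  have "inner_on ?n (u p) (apply_on ?n ?M (u p)) = d p"
    using eigenbasis_coordinates[OF eb sym p(1)] eb p(1)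
    by (simp add: eigenbasis_on_def orthonormal_on_def)
  then have "\<bar>d p\<bar> = \<bar>\<Sum>l<?n. \<Sum>m<?n. ?M l m * u p l * u p m\<bar>"
    by (simp add: inner_on_apply_on)
  also have "\<dots> \<le> (\<Sum>l<?n. \<Sum>m<?n. \<bar>?M l m * u p l * u p m\<bar>)"
    by (intro order_trans[OF sum_abs] sum_mono order_refl)
  also have "\<dots> \<le> (\<Sum>l<?n. \<Sum>m<?n. ((u p l)\<^sup>2 + (u p m)\<^sup>2) / 2)"
  proof (intro sum_mono)
    fix l m
    have "\<bar>?M l m * u p l * u p m\<bar> \<le> \<bar>u p l\<bar> * \<bar>u p m\<bar>"
      by (simp add: adjacency_function_def abs_mult)
    also have "\<dots> \<le> ((u p l)\<^sup>2 + (u p m)\<^sup>2) / 2"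
      using sum_squares_bound[of "\<bar>u p l\<bar>" "\<bar>u p m\<bar>"] by simp
    finally show "\<bar>?M l m * u p l * u p m\<bar> \<le> ((u p l)\<^sup>2 + (u p m)\<^sup>2) / 2" .
  qed
  also have "\<dots> = ?n"
    by (simp add: sum.distrib one flip: sum_divide_distrib sum_distrib_left)
  finally show ?thesis
    using p(2) by simp
qed

lemma eigenvalue_const_ge_largest:
  assumes "pair_graph G" "1 \<le> j" "j \<le> card (pverts G)"
  shows "graph_eigenvalue j G / card (pverts G) \<le> eigenvalue_const (int j)"
proof -
  have "bdd_above {graph_eigenvalue j G / real (card (pverts G)) | G.
      pair_graph G \<and> card (pverts G) \<ge> j}"
  proof (rule bdd_aboveI[of _ 1], safe)
    fix H :: "nat pair_pre_digraph" assume "pair_graph H" "j \<le> card (pverts H)"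
    then show "graph_eigenvalue j H / real (card (pverts H)) \<le> 1"
      using abs_graph_eigenvalue_le[of H j] assms(2) by (simp add: field_simps)
  qed
  then show ?thesis
    using assms by (auto simp: eigenvalue_const_def intro!: cSup_upper)
qed

lemma eigenvalue_const_ge_smallest:
  assumes "pair_graph G" "1 \<le> j" "j \<le> card (pverts G)"
  shows "\<bar>graph_eigenvalue (card (pverts G) - j + 1) G\<bar> / card (pverts G) \<le> eigenvalue_const (- int j)"
proof -
  have "bdd_above {\<bar>graph_eigenvalue (card (pverts G) - j + 1) G\<bar> / real (card (pverts G)) | G.
      pair_graph G \<and> card (pverts G) \<ge> j}"
  proof (rule bdd_aboveI[of _ 1], safe)
    fix H :: "nat pair_pre_digraph" assume "pair_graph H" "j \<le> card (pverts H)"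
    then show "\<bar>graph_eigenvalue (card (pverts H) - j + 1) H\<bar> / real (card (pverts H)) \<le> 1"
      using abs_graph_eigenvalue_le[of H "card (pverts H) - j + 1"] assms(2) by (simp add: field_simps)
  qed
  then show ?thesis
    using assms by (auto simp: eigenvalue_const_def intro!: cSup_upper)
qed

definition graph_on :: "nat \<Rightarrow> (nat \<Rightarrow> nat \<Rightarrow> bool) \<Rightarrow> nat pair_pre_digraph" where
  "graph_on n E = \<lparr>pverts = {..<n}, parcs = {(i, j). i < n \<and> j < n \<and> E i j}\<rparr>"

lemma card_graph_on [simp]: "card (pverts (graph_on n E)) = n"
  by (simp add: graph_on_def)

lemma pair_graph_graph_on:
  assumes "\<And>i j. i < n \<Longrightarrow> j < n \<Longrightarrow> E i j \<Longrightarrow> E j i" "\<And>i. i < n \<Longrightarrow> \<not> E i i"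
  shows "pair_graph (graph_on n E)"
proof
  show "finite (parcs (graph_on n E))"
    by (rule finite_subset[of _ "{..<n} \<times> {..<n}"]) (auto simp: graph_on_def)
  show "symmetric (with_proj (graph_on n E))"
    using assms(1)
    by (auto simp: graph_on_def symmetric_def arcs_ends_def arc_to_ends_def intro!: symI)
qed (use assms(2) in \<open>auto simp: graph_on_def\<close>)

lemma adjacency_function_graph_on:
  "i < n \<Longrightarrow> j < n \<Longrightarrow> adjacency_function (graph_on n E) i j = of_bool (E i j)"
  unfolding adjacency_function_def graph_on_def lessThan_atLeast0 by simp

section \<open>Patterns whose form is large on a subspace\<close>

definition reflexive_pattern :: "nat \<Rightarrow> (nat \<Rightarrow> nat \<Rightarrow> real) \<Rightarrow> bool" where
  "reflexive_pattern n A \<longleftrightarrow>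
     (\<forall>i<n. A i i = 1) \<and> (\<forall>i<n. \<forall>j<n. A i j = A j i \<and> A i j \<in> {0, 1})"

text \<open>
  A lower bound \<open>\<beta>\<close> for the \<open>k\<close>-th largest eigenvalue of a reflexive adjacency matrix, phrased by a subspace so
  that it can be transported to blow-ups, complements and disjoint unions without computing spectra. By
  orthonormality the sum of the squared coefficients is the squared norm of the combination.
\<close>

definition spectral_pattern :: "nat \<Rightarrow> nat \<Rightarrow> real \<Rightarrow> bool" where
  "spectral_pattern n k \<beta> \<longleftrightarrow> (\<exists>A v. reflexive_pattern n A \<and> orthonormal_on n k v \<and>
     (\<forall>c. \<beta> * (\<Sum>a<k. (c a)\<^sup>2) \<le> inner_on n (lin_comb k c v) (apply_on n A (lin_comb k c v))))"

lemma sum_mod_mult: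
  fixes f :: "nat \<Rightarrow> real"
  shows "(\<Sum>i<t * n. f (i mod n)) = t * (\<Sum>i<n. f i)"
proof -
  have "(\<Sum>i<t * n. f (i mod n)) = (\<Sum>s<t. \<Sum>i\<in>{s * n..<s * n + n}. f (i mod n))"
    by (rule sum.nat_group[symmetric])
  also have "\<dots> = (\<Sum>s<t. \<Sum>i<n. f i)"
  proof (rule sum.cong[OF refl])
    fix s
    have "(\<Sum>i\<in>{s * n..<s * n + n}. f (i mod n)) = (\<Sum>i\<in>{0..<n}. f ((i + s * n) mod n))"
      using sum.shift_bounds_nat_ivl[of "\<lambda>i. f (i mod n)" 0 "s * n" n] by (simp add: add.commute)
    also have "\<dots> = (\<Sum>i<n. f i)"
      unfolding lessThan_atLeast0 by (intro sum.cong) auto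
    finally show "(\<Sum>i\<in>{s * n..<s * n + n}. f (i mod n)) = (\<Sum>i<n. f i)" .
  qed
  finally show ?thesis by simp
qed

text \<open>
  Vertex \<open>i\<close> of the blow-up is a copy of vertex \<open>i mod n\<close> of the pattern, and copies of one vertex are
  adjacent since the pattern is reflexive. A vector spread evenly over the copies keeps its norm after
  division by \<open>sqrt t\<close>, while the form of the pattern is multiplied by \<open>t\<close>. Omitting the loops subtracts the
  identity matrix, which costs 1 in the eigenvalue and \<open>1/(tn)\<close> in the ratio.
\<close>

lemma spectral_pattern_largest:
  assumes pat: "spectral_pattern n k \<beta>" and "1 \<le> k"
  shows "\<beta> / n \<le> eigenvalue_const (int k)"
proof -
  obtain A v where A: "reflexive_pattern n A" and v: "orthonormal_on n k v"
    and form: "\<And>c. \<beta> * (\<Sum>a<k. (c a)\<^sup>2) \<le> inner_on n (lin_comb k c v) (apply_on n A (lin_comb k c v))"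
    using pat by (auto simp: spectral_pattern_def)
  have "k \<le> n"
    using v by (rule orthonormal_le)
  with \<open>1 \<le> k\<close> have n: "0 < n" by simp
  have bound: "\<beta> / n - (1 / n) * inverse (real t) \<le> eigenvalue_const (int k)" if t: "0 < t" for t :: nat
  proof -
    define G where "G = graph_on (t * n) (\<lambda>i j. i \<noteq> j \<and> A (i mod n) (j mod n) = 1)"
    have G: "pair_graph G"
      unfolding G_def using A n by (intro pair_graph_graph_on) (auto simp: reflexive_pattern_def)
    have cardG [simp]: "card (pverts G) = t * n"
      by (simp add: G_def)
    obtain d u where sym: "sym_on (t * n) (adjacency_function G)"
      and eb: "eigenbasis_on (t * n) (adjacency_function G) d u"
      and ev: "graph_eigenvalues G = rev (sorted_list_of_multiset (image_mset d (mset_set {..<t * n})))"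
      using adjacency_eigenbasis[OF G] unfolding cardG .
    have adj: "adjacency_function G i j = A (i mod n) (j mod n) - of_bool (i = j)"
      if "i < t * n" "j < t * n" for i j
    proof -
      have "A (i mod n) (j mod n) \<in> {0, 1}" "A (i mod n) (i mod n) = 1"
        using A n by (auto simp: reflexive_pattern_def)
      then show ?thesis
        unfolding G_def adjacency_function_graph_on[OF that] by auto
    qed
    define w where "w a i = v a (i mod n) / sqrt t" for a i
    have lift: "inner_on (t * n) (\<lambda>i. x (i mod n) / sqrt t) (\<lambda>i. y (i mod n) / sqrt t) = inner_on n x y"
      for x y
    proof -
      have "inner_on (t * n) (\<lambda>i. x (i mod n) / sqrt t) (\<lambda>i. y (i mod n) / sqrt t)
          = (\<Sum>i<t * n. x (i mod n) * y (i mod n) / t)"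
        using t by (simp add: inner_on_def)
      also have "\<dots> = t * (\<Sum>i<n. x i * y i / t)"
        by (rule sum_mod_mult)
      finally show ?thesis
        using t by (simp add: inner_on_def flip: sum_divide_distrib)
    qed
    have w: "orthonormal_on (t * n) k w"
    proof -
      have "w a = (\<lambda>i. v a (i mod n) / sqrt t)" for a
        by (simp add: w_def fun_eq_iff)
      then show ?thesis
        using v by (simp add: orthonormal_on_def lift)
    qed
    have "k \<le> card {i. i < t * n \<and> t * \<beta> - 1 \<le> d i} + 0"
    proof (rule eigenvalues_at_least[OF eb sym w])
      fix c :: "nat \<Rightarrow> real"
      let ?x = "lin_comb k c v" and ?y = "lin_comb k c w"
      have y: "?y i = ?x (i mod n) / sqrt t" for i
        by (simp add: lin_comb_def w_def sum_divide_distrib)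
      have My: "apply_on (t * n) (adjacency_function G) ?y i
          = (t * apply_on n A ?x (i mod n) - ?x (i mod n)) / sqrt t" if "i < t * n" for i
      proof -
        have "apply_on (t * n) (adjacency_function G) ?y i
            = (\<Sum>j<t * n. A (i mod n) (j mod n) * ?x (j mod n) / sqrt t - of_bool (i = j) * ?y j)"
          unfolding apply_on_def using adj that by (intro sum.cong) (auto simp: y left_diff_distrib diff_divide_distrib)
        also have "\<dots> = (\<Sum>j<t * n. A (i mod n) (j mod n) * ?x (j mod n) / sqrt t)
            - (\<Sum>j<t * n. if j = i then ?y j else 0)"
          unfolding sum_subtractf by (intro arg_cong2[of _ _ _ _ "(-)"] sum.cong) auto
        also have "\<dots> = (t * (\<Sum>j<n. A (i mod n) j * ?x j / sqrt t)) - ?y i"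
          using that by (simp add: sum_mod_mult[of "\<lambda>j. A (i mod n) j * ?x j / sqrt t"])
        also have "\<dots> = (t * apply_on n A ?x (i mod n) - ?x (i mod n)) / sqrt t"
          by (simp add: y apply_on_def diff_divide_distrib flip: sum_divide_distrib)
        finally show ?thesis .
      qed
      have "inner_on (t * n) ?y (apply_on (t * n) (adjacency_function G) ?y)
          = inner_on (t * n) (\<lambda>i. ?x (i mod n) / sqrt t)
              (\<lambda>i. (\<lambda>l. t * apply_on n A ?x l - ?x l) (i mod n) / sqrt t)"
        using My by (intro inner_on_cong) (auto simp: y)
      also have "\<dots> = inner_on n ?x (\<lambda>l. t * apply_on n A ?x l - ?x l)"
        by (rule lift)
      also have "\<dots> = t * inner_on n ?x (apply_on n A ?x) - (\<Sum>a<k. (c a)\<^sup>2)"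
        unfolding norm_orthonormal_lin_comb[OF v, symmetric]
        by (simp add: inner_on_def right_diff_distrib sum_subtractf sum_distrib_left mult.left_commute)
      also have "\<dots> \<ge> t * (\<beta> * (\<Sum>a<k. (c a)\<^sup>2)) - (\<Sum>a<k. (c a)\<^sup>2)"
        using form[of c] by (intro diff_right_mono mult_left_mono) auto
      finally show "(t * \<beta> - 1) * (\<Sum>a<k. (c a)\<^sup>2)
          \<le> inner_on (t * n) ?y (apply_on (t * n) (adjacency_function G) ?y)"
        by (simp add: left_diff_distrib mult.assoc)
    qed
    moreover define L where "L = sorted_list_of_multiset (image_mset d (mset_set {..<t * n}))"
    moreover have L: "length L = t * n" "sorted L"
      using length_filter_sorted_list_image[of "\<lambda>_. True" d "t * n"] by (simp_all add: L_def)
    moreover have "k \<le> t * n"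
      using orthonormal_le[OF w] .
    ultimately have "t * \<beta> - 1 \<le> L ! (t * n - k)"
      using sorted_nth_ge[of L k "t * \<beta> - 1"] \<open>1 \<le> k\<close>
        length_filter_sorted_list_image[of "\<lambda>x. t * \<beta> - 1 \<le> x" d "t * n"] by simp
    also have "\<dots> = graph_eigenvalue k G"
      using \<open>1 \<le> k\<close> \<open>k \<le> t * n\<close> L by (simp add: graph_eigenvalue_def ev L_def[symmetric] rev_nth)
    finally have "(t * \<beta> - 1) / (t * n) \<le> graph_eigenvalue k G / card (pverts G)"
      by (simp add: divide_right_mono)
    also have "\<dots> \<le> eigenvalue_const (int k)"
      using G \<open>1 \<le> k\<close> \<open>k \<le> t * n\<close> by (intro eigenvalue_const_ge_largest) auto
    also have "(t * \<beta> - 1) / (t * n) = \<beta> / n - (1 / n) * inverse (real t)"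
      using t n by (simp add: field_simps)
    finally show ?thesis .
  qed
  have "(\<lambda>t. \<beta> / n - (1 / n) * inverse (real (Suc t))) \<longlonglongrightarrow> \<beta> / n - (1 / n) * 0"
    by (intro tendsto_intros LIMSEQ_inverse_real_of_nat)
  then have "\<beta> / n - (1 / n) * 0 \<le> eigenvalue_const (int k)"
    by (rule LIMSEQ_le_const2) (use bound[OF zero_less_Suc] in blast)
  then show ?thesis by simp
qed

text \<open>
  The pattern has all loops, so its complement, with the matrix \<open>J - A\<close>, is a simple graph. On the subspace
  the form of \<open>-A\<close> is at most \<open>-\<beta> |x|\<^sup>2\<close>, and \<open>J\<close> vanishes on vectors orthogonal to the all-ones vector. This one condition is
  the reason why \<open>j + 1\<close> dimensions yield \<open>j\<close> eigenvalues.
\<close>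

lemma spectral_pattern_smallest:
  assumes pat: "spectral_pattern n (Suc j) \<beta>" and "1 \<le> j"
  shows "\<beta> / n \<le> eigenvalue_const (- int j)"
proof -
  obtain A v where A: "reflexive_pattern n A" and v: "orthonormal_on n (Suc j) v"
    and form: "\<And>c. \<beta> * (\<Sum>a<Suc j. (c a)\<^sup>2)
      \<le> inner_on n (lin_comb (Suc j) c v) (apply_on n A (lin_comb (Suc j) c v))"
    using pat unfolding spectral_pattern_def by metis
  have "Suc j \<le> n"
    using v by (rule orthonormal_le)
  define G where "G = graph_on n (\<lambda>i j. A i j = 0)"
  have G: "pair_graph G"
    unfolding G_def using A by (intro pair_graph_graph_on) (auto simp: reflexive_pattern_def)
  have cardG [simp]: "card (pverts G) = n"
    by (simp add: G_def)
  obtain d u where sym: "sym_on n (adjacency_function G)"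
    and eb: "eigenbasis_on n (adjacency_function G) d u"
    and ev: "graph_eigenvalues G = rev (sorted_list_of_multiset (image_mset d (mset_set {..<n})))"
    using adjacency_eigenbasis[OF G] unfolding cardG .
  have adj: "adjacency_function G i j = 1 - A i j" if "i < n" "j < n" for i j
  proof -
    have "A i j \<in> {0, 1}"
      using A that by (simp add: reflexive_pattern_def)
    then show ?thesis
      unfolding G_def adjacency_function_graph_on[OF that] by auto
  qed
  have "Suc j \<le> card {i. i < n \<and> d i \<le> - \<beta>} + 1"
  proof (rule eigenvalues_at_most[OF eb sym v, where w = "\<lambda>_ _. 1"])
    fix c :: "nat \<Rightarrow> real"
    let ?x = "lin_comb (Suc j) c v"
    assume perp: "\<And>i. i < (1 :: nat) \<Longrightarrow> inner_on n (\<lambda>_. 1) ?x = 0"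
    have "(\<Sum>l<n. ?x l) = 0"
      using perp[of 0] by (simp add: inner_on_def)
    moreover have "apply_on n (adjacency_function G) ?x l = (\<Sum>l<n. ?x l) - apply_on n A ?x l"
      if "l < n" for l
      using adj[OF that] by (simp add: apply_on_def left_diff_distrib sum_subtractf)
    ultimately have "inner_on n ?x (apply_on n (adjacency_function G) ?x) = - inner_on n ?x (apply_on n A ?x)"
      by (simp add: inner_on_def sum_negf)
    then show "inner_on n ?x (apply_on n (adjacency_function G) ?x) \<le> - \<beta> * (\<Sum>a<Suc j. (c a)\<^sup>2)"
      using form[of c] by simp
  qed
  moreover define L where "L = sorted_list_of_multiset (image_mset d (mset_set {..<n}))"
  moreover have L: "length L = n" "sorted L"
    using length_filter_sorted_list_image[of "\<lambda>_. True" d n] by (simp_all add: L_def)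
  ultimately have "L ! (j - 1) \<le> - \<beta>"
    using sorted_nth_le[of L j "- \<beta>"] \<open>1 \<le> j\<close>
      length_filter_sorted_list_image[of "\<lambda>x. x \<le> - \<beta>" d n] by simp
  also have "L ! (j - 1) = graph_eigenvalue (n - j + 1) G"
    using \<open>1 \<le> j\<close> \<open>Suc j \<le> n\<close> L by (simp add: graph_eigenvalue_def ev L_def[symmetric] rev_nth)
  finally have "\<beta> / n \<le> \<bar>graph_eigenvalue (n - j + 1) G\<bar> / n"
    by (intro divide_right_mono) auto
  also have "\<dots> \<le> eigenvalue_const (- int j)"
    using eigenvalue_const_ge_smallest[OF G \<open>1 \<le> j\<close>] \<open>Suc j \<le> n\<close> by simp
  finally show ?thesis .
qed

lemma sum_lessThan_add: "(\<Sum>i<n + b. f i) = (\<Sum>i<n. f i) + (\<Sum>i<b. f (n + i))"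
  for f :: "nat \<Rightarrow> real"
  by (induction b) (simp_all add: add.assoc)

text \<open>
  The all-ones matrix of order \<open>b\<close> has the eigenvalue \<open>b\<close>, with the constant vector as eigenvector, so a
  disjoint clique of that size adds one dimension at the same level.
\<close>

lemma spectral_pattern_add_clique:
  assumes pat: "spectral_pattern n k (real b)" and b: "0 < b"
  shows "spectral_pattern (n + b) (Suc k) (real b)"
proof -
  obtain A v where A: "reflexive_pattern n A" and v: "orthonormal_on n k v"
    and form: "\<And>c. real b * (\<Sum>a<k. (c a)\<^sup>2) \<le> inner_on n (lin_comb k c v) (apply_on n A (lin_comb k c v))"
    using pat by (auto simp: spectral_pattern_def)
  define B where "B i j = (if i < n \<and> j < n then A i j else of_bool (n \<le> i \<and> n \<le> j))" for i j
  define w where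
    "w a i = (if a < k then if i < n then v a i else 0 else if i < n then 0 else 1 / sqrt b)" for a i
  have B: "reflexive_pattern (n + b) B"
    using A by (auto simp: reflexive_pattern_def B_def)
  have w: "orthonormal_on (n + b) (Suc k) w"
    using v b by (auto simp: orthonormal_on_def inner_on_def sum_lessThan_add w_def less_Suc_eq)
  have "real b * (\<Sum>a<Suc k. (c a)\<^sup>2)
      \<le> inner_on (n + b) (lin_comb (Suc k) c w) (apply_on (n + b) B (lin_comb (Suc k) c w))" for c
  proof -
    let ?x = "lin_comb k c v" and ?y = "lin_comb (Suc k) c w"
    have y: "?y i = ?x i" if "i < n" for i
      using that by (simp add: lin_comb_def w_def)
    have y': "?y (n + i) = c k / sqrt b" for i
      by (simp add: lin_comb_def w_def)
    have My: "apply_on (n + b) B ?y i = apply_on n A ?x i" if "i < n" for i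
      using that by (simp add: apply_on_def sum_lessThan_add B_def y)
    have My': "apply_on (n + b) B ?y (n + i) = b * (c k / sqrt b)" for i
      by (simp add: apply_on_def sum_lessThan_add B_def y')
    have "inner_on (n + b) ?y (apply_on (n + b) B ?y)
        = inner_on n ?x (apply_on n A ?x) + b * ((c k / sqrt b) * (b * (c k / sqrt b)))"
      by (simp add: inner_on_def sum_lessThan_add y y' My My')
    also have "b * ((c k / sqrt b) * (b * (c k / sqrt b))) = b * (c k)\<^sup>2"
      using b by (simp add: power2_eq_square)
    finally show ?thesis
      using form[of c] by (simp add: distrib_left)
  qed
  with B w show ?thesis
    unfolding spectral_pattern_def by blast
qed

lemma spectral_pattern_add_cliques:
  assumes "spectral_pattern n k (real b)" "0 < b"
  shows "spectral_pattern (n + m * b) (k + m) (real b)"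
proof (induction m)
  case (Suc m)
  then show ?case
    using spectral_pattern_add_clique[OF Suc assms(2)] by (simp add: ac_simps)
qed (use assms in simp)

lemma spectral_pattern_mono:
  assumes "spectral_pattern n k \<beta>" "j \<le> k"
  shows "spectral_pattern n j \<beta>"
proof -
  obtain A v where A: "reflexive_pattern n A" and v: "orthonormal_on n k v"
    and form: "\<And>c. \<beta> * (\<Sum>a<k. (c a)\<^sup>2) \<le> inner_on n (lin_comb k c v) (apply_on n A (lin_comb k c v))"
    using assms(1) by (auto simp: spectral_pattern_def)
  have "orthonormal_on n j v"
    using v assms(2) by (simp add: orthonormal_on_def)
  moreover have "\<beta> * (\<Sum>a<j. (c a)\<^sup>2) \<le> inner_on n (lin_comb j c v) (apply_on n A (lin_comb j c v))" for c
  proof -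
    have trunc: "(\<Sum>a<k. if a < j then g a else 0) = (\<Sum>a<j. g a)" for g :: "nat \<Rightarrow> real"
      using assms(2) by (intro sum.mono_neutral_cong_right) auto
    let ?c = "\<lambda>a. if a < j then c a else 0"
    have "lin_comb k ?c v = lin_comb j c v"
      using trunc[of "\<lambda>a. c a * v a l" for l]
      by (intro ext) (simp add: lin_comb_def if_distrib[of "\<lambda>x. x * _"] cong: if_cong)
    moreover have "(\<Sum>a<k. (?c a)\<^sup>2) = (\<Sum>a<j. (c a)\<^sup>2)"
      using trunc[of "\<lambda>a. (c a)\<^sup>2"] by (simp add: if_distrib[of "\<lambda>x. x\<^sup>2"] cong: if_cong)
    ultimately show ?thesis
      using form[of ?c] by simp
  qed
  ultimately show ?thesis
    using A unfolding spectral_pattern_def by blast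
qed

text \<open>
  The subspace is given as the range of an orthogonal projection \<open>P\<close>, which avoids writing down a basis. The
  eigenvalues of \<open>P\<close> are 0 and 1, so its trace counts the eigenvalues 1, and the eigenvectors for these are
  an orthonormal basis of the range.
\<close>

lemma spectral_pattern_projection:
  fixes A P :: "'a \<Rightarrow> 'a \<Rightarrow> real"
  assumes I: "finite I" and A1: "\<And>i. i \<in> I \<Longrightarrow> A i i = 1"
    and A: "\<And>i j. i \<in> I \<Longrightarrow> j \<in> I \<Longrightarrow> A i j = A j i \<and> A i j \<in> {0, 1}"
    and P: "\<And>i j. i \<in> I \<Longrightarrow> j \<in> I \<Longrightarrow> P i j = P j i"
    and idem: "\<And>i j. i \<in> I \<Longrightarrow> j \<in> I \<Longrightarrow> (\<Sum>z\<in>I. P i z * P z j) = P i j"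
    and trace: "(\<Sum>i\<in>I. P i i) = real k"
    and form: "\<And>x. (\<And>i. i \<in> I \<Longrightarrow> (\<Sum>j\<in>I. P i j * x j) = x i) \<Longrightarrow>
      \<beta> * (\<Sum>i\<in>I. (x i)\<^sup>2) \<le> (\<Sum>i\<in>I. \<Sum>j\<in>I. A i j * x i * x j)"
  shows "spectral_pattern (card I) k \<beta>"
proof -
  define n where "n = card I"
  obtain e where e: "bij_betw e {..<n} I"
    using ex_bij_betw_nat_finite[OF I] by (auto simp: n_def lessThan_atLeast0)
  have eI: "e i \<in> I" if "i < n" for i
    using e that by (auto simp: bij_betw_def)
  have sum_e: "(\<Sum>i<n. f (e i)) = (\<Sum>i\<in>I. f i)" for f :: "'a \<Rightarrow> real"
    using sum.reindex_bij_betw[OF e] .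
  define A' where "A' i j = A (e i) (e j)" for i j
  define P' where "P' i j = P (e i) (e j)" for i j
  have "reflexive_pattern n A'"
    using A A1 eI by (auto simp: reflexive_pattern_def A'_def)
  have symP: "sym_on n P'"
    using P eI by (simp add: sym_on_def P'_def)
  obtain d u where eb: "eigenbasis_on n P' d u"
    using spectral_theorem[OF symP] by blast
  have u: "orthonormal_on n n u" and eig: "\<And>i l. i < n \<Longrightarrow> l < n \<Longrightarrow> apply_on n P' (u i) l = d i * u i l"
    using eb by (auto simp: eigenbasis_on_def)
  have PP: "apply_on n P' (apply_on n P' x) l = apply_on n P' x l" if "l < n" for x l
  proof -
    have "apply_on n P' (apply_on n P' x) l = (\<Sum>m<n. \<Sum>r<n. P' l m * P' m r * x r)"
      by (simp add: apply_on_def sum_distrib_left mult.assoc)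
    also have "\<dots> = (\<Sum>r<n. \<Sum>m<n. P' l m * P' m r * x r)"
      by (rule sum.swap)
    also have "\<dots> = (\<Sum>r<n. P' l r * x r)"
      using idem[OF eI[OF that] eI] sum_e[of "\<lambda>z. P (e l) z * P z (e r)" for r]
      by (intro sum.cong) (auto simp: P'_def simp flip: sum_distrib_right)
    finally show ?thesis
      by (simp add: apply_on_def)
  qed
  have d01: "d i \<in> {0, 1}" if "i < n" for i
  proof -
    have "inner_on n (u i) (u i) = 1"
      using u that by (simp add: orthonormal_on_def)
    moreover have "inner_on n (u i) (apply_on n P' (u i)) = d i * inner_on n (u i) (u i)" 
      by (rule eigenbasis_coordinates[OF eb symP that])
    moreover have "inner_on n (u i) (apply_on n P' (apply_on n P' (u i)))
        = d i * inner_on n (u i) (apply_on n P' (u i))"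
      by (rule eigenbasis_coordinates[OF eb symP that])
    moreover have "inner_on n (u i) (apply_on n P' (apply_on n P' (u i))) = inner_on n (u i) (apply_on n P' (u i))"
      by (intro inner_on_cong PP refl)
    ultimately show ?thesis by auto
  qed
  \<comment> \<open>The trace is the number of eigenvalues equal to 1.\<close>
  define S where "S = {i. i < n \<and> d i = 1}"
  have "real k = (\<Sum>i<n. d i)"
    using trace sum_e[of "\<lambda>i. P i i"] trace_eigenbasis[OF eb] by (simp add: P'_def)
  also have "\<dots> = (\<Sum>i\<in>S. 1)"
    using d01 by (intro sum.mono_neutral_cong_right) (auto simp: S_def)
  finally have "card S = k" by simp
  then obtain h where h: "bij_betw h {..<k} S"
    using ex_bij_betw_nat_finite[of S] by (auto simp: S_def lessThan_atLeast0)
  then have hS: "h a < n \<and> d (h a) = 1" if "a < k" for a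
    using that by (auto simp: bij_betw_def S_def)
  define v where "v a = u (h a)" for a
  have "h a = h b \<longleftrightarrow> a = b" if "a < k" "b < k" for a b
    using h that by (auto simp: bij_betw_def inj_on_def)
  then have v: "orthonormal_on n k v"
    using u hS by (simp add: orthonormal_on_def v_def)
  have "\<beta> * (\<Sum>a<k. (c a)\<^sup>2) \<le> inner_on n (lin_comb k c v) (apply_on n A' (lin_comb k c v))" for c
  proof -
    let ?x = "lin_comb k c v"
    have Px: "apply_on n P' ?x l = ?x l" if "l < n" for l
      unfolding apply_on_lin_comb lin_comb_def using eig hS that by (simp add: v_def)
    define e' where "e' = inv_into {..<n} e"
    have e': "e' (e l) = l" if "l < n" for l
      using e that by (simp add: e'_def bij_betw_def)
    define x where "x z = ?x (e' z)" for z
    have "(\<Sum>j\<in>I. P i j * x j) = x i" if i: "i \<in> I" for i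
    proof -
      obtain l where "l < n" "i = e l"
        using e i by (auto simp: bij_betw_def)
      then show ?thesis
        using Px[of l] by (simp add: sum_e[symmetric] x_def e' apply_on_def P'_def)
    qed
    then have "\<beta> * (\<Sum>i\<in>I. (x i)\<^sup>2) \<le> (\<Sum>i\<in>I. \<Sum>j\<in>I. A i j * x i * x j)"
      by (rule form)
    then show ?thesis
      unfolding norm_orthonormal_lin_comb[OF v, symmetric] inner_on_apply_on
      by (simp add: sum_e[symmetric] x_def e' A'_def inner_on_def power2_eq_square)
  qed
  with \<open>reflexive_pattern n A'\<close> v show ?thesis
    unfolding spectral_pattern_def n_def by blast
qed

section \<open>Lines in the grid of a cyclic group\<close>

text \<open>
  Rows, columns and diagonals are three parallel classes of lines in the \<open>m \<times> m\<close> grid, for every \<open>m\<close>: the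
  diagonals are the symbols of the addition table modulo \<open>m\<close>, which is a Latin square. The number \<open>i\<close> selects
  the class, and the value is the line of this class through \<open>z\<close>.
\<close>

definition coord :: "nat \<Rightarrow> nat \<Rightarrow> nat \<times> nat \<Rightarrow> nat" where
  "coord m i z = (if i = 0 then fst z else if i = 1 then snd z else (fst z + snd z) mod m)"

text \<open>
  For distinct points this is the adjacency matrix of the Latin square graph on the first \<open>g\<close> classes.
\<close>

definition common_lines :: "nat \<Rightarrow> nat \<Rightarrow> nat \<times> nat \<Rightarrow> nat \<times> nat \<Rightarrow> real" where
  "common_lines g m x y = (\<Sum>i<g. of_bool (coord m i x = coord m i y))"

abbreviation grid :: "nat \<Rightarrow> (nat \<times> nat) set" where
  "grid m \<equiv> {..<m} \<times> {..<m}"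

lemma coord_less: "z \<in> grid m \<Longrightarrow> coord m i z < m"
  by (auto simp: coord_def)

lemma mod_add_eq_iff:
  fixes u b v m :: nat
  assumes "u < m" "b < m" "v < m"
  shows "(u + b) mod m = v \<longleftrightarrow> b = (v + (m - u)) mod m"
  using assms by (auto simp: mod_if)

lemma unique_intersection:
  assumes "i < 3" "j < 3" "i \<noteq> j" "u < m" "v < m"
  shows "\<exists>w\<in>grid m. \<forall>z\<in>grid m. coord m i z = u \<and> coord m j z = v \<longleftrightarrow> z = w"
proof -
  have *: "\<exists>w\<in>grid m. \<forall>z\<in>grid m. coord m i z = u \<and> coord m j z = v \<longleftrightarrow> z = w"
    if "i < j" "j < 3" "u < m" "v < m" for i j u v
  proof -
    have "i = 0 \<and> j = 1 \<or> i = 0 \<and> j = 2 \<or> i = 1 \<and> j = 2"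
      using \<open>i < j\<close> \<open>j < 3\<close> by arith
    then consider "i = 0" "j = 1" | "i = 0" "j = 2" | "i = 1" "j = 2"
      by blast
    then show ?thesis
    proof cases
      case 1
      then show ?thesis
        using that by (intro bexI[of _ "(u, v)"]) (auto simp: coord_def)
    next
      case 2
      then show ?thesis
        using that mod_add_eq_iff[of u m _ v]
        by (intro bexI[of _ "(u, (v + (m - u)) mod m)"]) (auto simp: coord_def)
    next
      case 3
      then show ?thesis
        using that mod_add_eq_iff[of u m _ v]
        by (intro bexI[of _ "((v + (m - u)) mod m, u)"]) (auto simp: coord_def add.commute)
    qed
  qed
  show ?thesis
    using *[of i j u v] *[of j i v u] assms by (cases "i < j") auto
qed

lemma sum_intersection:
  assumes "i < 3" "j < 3" "i \<noteq> j" "u < m" "v < m"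
  shows "(\<Sum>z\<in>grid m. of_bool (coord m i z = u) * of_bool (coord m j z = v)) = (1 :: real)"
proof -
  obtain w where w: "w \<in> grid m"
    "\<And>z. z \<in> grid m \<Longrightarrow> coord m i z = u \<and> coord m j z = v \<longleftrightarrow> z = w"
    using unique_intersection[OF assms] by blast
  have "(\<Sum>z\<in>grid m. of_bool (coord m i z = u) * of_bool (coord m j z = v))
      = (\<Sum>z\<in>grid m. if z = w then 1 else 0 :: real)"
    using w(2) by (intro sum.cong) (auto simp flip: of_bool_conj)
  then show ?thesis
    using w(1) by simp
qed

lemma sum_line:
  assumes "i < 3" "u < m"
  shows "(\<Sum>z\<in>grid m. of_bool (coord m i z = u)) = real m"
proof -
  define j :: nat where "j = (if i = 0 then 1 else 0)"
  have j: "j < 3" "i \<noteq> j"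
    by (auto simp: j_def)
  have "(\<Sum>z\<in>grid m. of_bool (coord m i z = u) :: real)
      = (\<Sum>z\<in>grid m. \<Sum>v<m. of_bool (coord m i z = u) * of_bool (coord m j z = v))"
    using coord_less by (intro sum.cong) (simp_all add: of_bool_def)
  also have "\<dots> = (\<Sum>v<m. \<Sum>z\<in>grid m. of_bool (coord m i z = u) * of_bool (coord m j z = v))"
    by (rule sum.swap)
  also have "\<dots> = real m"
    using sum_intersection[OF assms(1) j assms(2)] by simp
  finally show ?thesis .
qed

lemma common_lines_commute: "common_lines g m x y = common_lines g m y x"
  by (simp add: common_lines_def eq_commute)

lemma common_lines_self: "common_lines g m x x = g"
  by (simp add: common_lines_def)

text \<open>
  Two points on two common lines would both be the unique intersection of these lines.
\<close>

lemma common_lines_01: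
  assumes "g \<le> 3" "x \<in> grid m" "y \<in> grid m" "x \<noteq> y"
  shows "common_lines g m x y \<in> {0, 1}"
proof -
  have unique: "i = j" if "i < g" "j < g" "coord m i x = coord m i y" "coord m j x = coord m j y" for i j
  proof (rule ccontr)
    assume "i \<noteq> j"
    then have "\<exists>w\<in>grid m. \<forall>z\<in>grid m.
        coord m i z = coord m i y \<and> coord m j z = coord m j y \<longleftrightarrow> z = w"
      using that assms coord_less by (intro unique_intersection) auto
    then obtain w where w: "\<forall>z\<in>grid m.
        coord m i z = coord m i y \<and> coord m j z = coord m j y \<longleftrightarrow> z = w"
      by blast
    have "x = w" "y = w"
      using bspec[OF w assms(2)] bspec[OF w assms(3)] that by simp_all
    then show False
      using assms(4) by simp
  qed
  define c where "c = card {i. i < g \<and> coord m i x = coord m i y}"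
  have "c \<le> 1"
    unfolding c_def using unique by (auto simp: card_le_Suc0_iff_eq)
  then have "c = 0 \<or> c = 1"
    by linarith
  moreover have "common_lines g m x y = c"
    by (auto simp: common_lines_def c_def intro!: arg_cong[of _ _ card])
  ultimately show ?thesis
    by auto
qed

lemma sum_common_lines:
  assumes "g \<le> 3" "x \<in> grid m"
  shows "(\<Sum>z\<in>grid m. common_lines g m x z) = g * m"
proof -
  have "(\<Sum>z\<in>grid m. common_lines g m x z) = (\<Sum>i<g. \<Sum>z\<in>grid m. of_bool (coord m i z = coord m i x))"
    unfolding common_lines_def by (subst sum.swap, intro sum.cong refl) auto
  also have "\<dots> = (\<Sum>i<g. real m)"
    using assms coord_less by (intro sum.cong refl sum_line) auto
  finally show ?thesis by simp
qed

text \<open>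
  Expand both factors over the classes. A line through \<open>x\<close> and a line through \<open>y\<close> meet in one point if their
  classes differ. In the same class they are equal, with \<open>m\<close> points, or disjoint. In matrix form:
  \<open>S\<^sup>2 = m S + g(g - 1) J\<close>.
\<close>

lemma sum_common_lines_mult:
  assumes "g \<le> 3" "x \<in> grid m" "y \<in> grid m"
  shows "(\<Sum>z\<in>grid m. common_lines g m x z * common_lines g m z y)
    = m * common_lines g m x y + g * (real g - 1)"
proof -
  let ?r = "\<lambda>i x y. of_bool (coord m i x = coord m i y) :: real"
  have r: "(\<Sum>z\<in>grid m. ?r i x z * ?r j z y) = (if i = j then m * ?r i x y else 1)"
    if "i < g" "j < g" for i j
  proof (cases "i = j")
    case True
    have "(\<Sum>z\<in>grid m. ?r i x z * ?r i z y) = (\<Sum>z\<in>grid m. of_bool (coord m i z = coord m i x) * ?r i x y)"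
      by (intro sum.cong) auto
    also have "\<dots> = m * ?r i x y"
      using sum_line[of i "coord m i x" m] that assms coord_less by (simp flip: sum_distrib_right)
    finally show ?thesis
      using True by simp
  next
    case False
    then show ?thesis
      using sum_intersection[of i j "coord m i x" m "coord m j y"] that assms coord_less
      by (simp add: eq_commute[of "coord m i x"])
  qed
  have "(\<Sum>z\<in>grid m. common_lines g m x z * common_lines g m z y)
      = (\<Sum>z\<in>grid m. \<Sum>i<g. \<Sum>j<g. ?r i x z * ?r j z y)"
    by (simp only: common_lines_def sum_product)
  also have "\<dots> = (\<Sum>i<g. \<Sum>z\<in>grid m. \<Sum>j<g. ?r i x z * ?r j z y)"
    by (rule sum.swap)
  also have "\<dots> = (\<Sum>i<g. \<Sum>j<g. \<Sum>z\<in>grid m. ?r i x z * ?r j z y)"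
    by (intro sum.cong refl sum.swap)
  also have "\<dots> = (\<Sum>i<g. \<Sum>j<g. if i = j then m * ?r i x y else 1)"
    by (intro sum.cong refl, rule r) auto
  also have "\<dots> = (\<Sum>i<g. m * ?r i x y + (real g - 1))"
  proof (intro sum.cong refl)
    fix i assume "i \<in> {..<g}"
    have "(\<Sum>j<g. if i = j then m * ?r i x y else 1)
        = (\<Sum>j<g. 1 + (if i = j then m * ?r i x y - 1 else 0))"
      by (intro sum.cong) auto
    then show "(\<Sum>j<g. if i = j then m * ?r i x y else 1) = m * ?r i x y + (real g - 1)"
      using \<open>i \<in> {..<g}\<close> by (simp add: sum.distrib)
  qed
  also have "\<dots> = m * common_lines g m x y + g * (real g - 1)"
    by (simp add: common_lines_def sum.distrib sum_distrib_left)
  finally show ?thesis .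
qed

text \<open>
  The indicator functions of the lines in \<open>g\<close> classes span a space of dimension \<open>g(m - 1) + 1\<close>, since the lines
  of each class add up to the all-ones function. The projection onto it is \<open>P = S/m - ((g - 1)/m\<^sup>2) J\<close>. As
  \<open>A = S - (g - 1) I\<close>, every \<open>x\<close> in its range satisfies \<open>A x = (m - g + 1) x\<close> up to a nonnegative multiple of
  \<open>J x\<close>, and \<open>J\<close> is positive semidefinite.
\<close>

lemma latin_square_pattern:
  assumes g: "1 \<le> g" "g \<le> 3" and "0 < m"
  shows "spectral_pattern (m * m) (g * (m - 1) + 1) (real m - real g + 1)"
proof -
  let ?I = "grid m" and ?S = "common_lines g m"
  define A where "A x y = ?S x y - (real g - 1) * of_bool (x = y)" for x y
  define \<delta> where "\<delta> = (real g - 1) / m\<^sup>2"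
  define P where "P x y = ?S x y / m - \<delta>" for x y
  have m: "real m \<noteq> 0"
    using \<open>0 < m\<close> by simp
  have SS: "(\<Sum>z\<in>?I. ?S x z * ?S z y) = m * ?S x y + g * (real g - 1)"
    if "x \<in> ?I" "y \<in> ?I" for x y
    by (rule sum_common_lines_mult[OF g(2) that])
  have S1: "(\<Sum>z\<in>?I. ?S x z) = g * m" "(\<Sum>z\<in>?I. ?S z x) = g * m" if "x \<in> ?I" for x
    using sum_common_lines[OF g(2) that] by (simp_all add: common_lines_commute[of g m _ x])
  have "spectral_pattern (card ?I) (g * (m - 1) + 1) (real m - real g + 1)"
  proof (rule spectral_pattern_projection[where A = A and P = P])
    show "(\<Sum>z\<in>?I. P x z * P z y) = P x y" if "x \<in> ?I" "y \<in> ?I" for x y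
    proof -
      have "(\<Sum>z\<in>?I. P x z * P z y) = (\<Sum>z\<in>?I. ?S x z * ?S z y) / m\<^sup>2
          - \<delta> / m * (\<Sum>z\<in>?I. ?S x z) - \<delta> / m * (\<Sum>z\<in>?I. ?S z y) + m\<^sup>2 * \<delta>\<^sup>2"
        unfolding P_def by (simp add: algebra_simps sum.distrib sum_subtractf sum_distrib_left
            sum_divide_distrib power2_eq_square)
      also have "\<dots> = (m * ?S x y + g * (real g - 1)) / m\<^sup>2 - 2 * (g * \<delta>) + m\<^sup>2 * \<delta>\<^sup>2"
        unfolding SS[OF that] S1(1)[OF that(1)] S1(2)[OF that(2)] using m by (simp add: field_simps)
      also have "\<dots> = P x y"
        unfolding P_def \<delta>_def using m by (simp add: field_simps power2_eq_square)
      finally show ?thesis .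
    qed
    show "(\<Sum>x\<in>?I. P x x) = real (g * (m - 1) + 1)"
      using m \<open>0 < m\<close> by (simp add: P_def \<delta>_def common_lines_self of_nat_diff field_simps power2_eq_square)
    show "(real m - real g + 1) * (\<Sum>i\<in>?I. (x i)\<^sup>2) \<le> (\<Sum>i\<in>?I. \<Sum>j\<in>?I. A i j * x i * x j)"
      if x: "\<And>i. i \<in> ?I \<Longrightarrow> (\<Sum>j\<in>?I. P i j * x j) = x i" for x
    proof -
      define s where "s = (\<Sum>j\<in>?I. x j)"
      have Ax: "(\<Sum>j\<in>?I. A i j * x j) = (real m - real g + 1) * x i + m * \<delta> * s" if "i \<in> ?I" for i
      proof -
        have "(\<Sum>j\<in>?I. A i j * x j)
            = (\<Sum>j\<in>?I. m * (P i j * x j) + m * \<delta> * x j - (if i = j then (real g - 1) * x j else 0))"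
          using m by (intro sum.cong) (auto simp: A_def P_def field_simps)
        also have "\<dots> = m * x i + m * \<delta> * s - (real g - 1) * x i"
          using that by (simp add: sum.distrib sum_subtractf s_def x flip: sum_distrib_left)
        finally show ?thesis
          by (simp add: algebra_simps)
      qed
      have "(\<Sum>i\<in>?I. \<Sum>j\<in>?I. A i j * x i * x j) = (\<Sum>i\<in>?I. x i * (\<Sum>j\<in>?I. A i j * x j))"
        by (simp add: sum_distrib_left mult_ac)
      also have "\<dots> = (\<Sum>i\<in>?I. (real m - real g + 1) * (x i)\<^sup>2 + m * \<delta> * s * x i)"
        by (intro sum.cong refl) (simp only: Ax, simp add: algebra_simps power2_eq_square)
      also have "\<dots> = (real m - real g + 1) * (\<Sum>i\<in>?I. (x i)\<^sup>2) + m * \<delta> * s\<^sup>2"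
        by (simp add: sum.distrib s_def power2_eq_square flip: sum_distrib_left)
      finally show ?thesis
        using g by (simp add: \<delta>_def)
    qed
    show "A x y = A y x \<and> A x y \<in> {0, 1}" if "x \<in> ?I" "y \<in> ?I" for x y
      using common_lines_01[OF g(2) that] common_lines_commute[of g m x y]
      by (cases "x = y") (auto simp: A_def common_lines_self)
    show "P x y = P y x" for x y
      by (simp add: P_def common_lines_commute[of g m x])
  qed (auto simp: A_def common_lines_self)
  then show ?thesis
    by (simp add: card_cartesian_product)
qed

section \<open>Symmetric Hadamard matrices with constant diagonal\<close>

definition hadamard_on :: "'a set \<Rightarrow> ('a \<Rightarrow> 'a \<Rightarrow> real) \<Rightarrow> nat \<Rightarrow> bool" where
  "hadamard_on I H s \<longleftrightarrow> finite I \<and> card I = s\<^sup>2 \<and> (\<forall>x\<in>I. H x x = 1) \<and>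
     (\<forall>x\<in>I. \<forall>y\<in>I. H x y = H y x \<and> H x y \<in> {1, - 1} \<and>
        (\<Sum>z\<in>I. H x z * H z y) = (if x = y then (real s)\<^sup>2 else 0))"

lemma hadamard_onI:
  assumes "finite I" "card I = s\<^sup>2" "\<And>x. x \<in> I \<Longrightarrow> H x x = 1"
    "\<And>x y. x \<in> I \<Longrightarrow> y \<in> I \<Longrightarrow> H x y = H y x"
    "\<And>x y. x \<in> I \<Longrightarrow> y \<in> I \<Longrightarrow> H x y \<in> {1, - 1}"
    "\<And>x y. x \<in> I \<Longrightarrow> y \<in> I \<Longrightarrow> (\<Sum>z\<in>I. H x z * H z y) = (if x = y then (real s)\<^sup>2 else 0)"
  shows "hadamard_on I H s"
  unfolding hadamard_on_def using assms by blast

lemma hadamard_onD: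
  assumes "hadamard_on I H s"
  shows "finite I" "card I = s\<^sup>2" "\<And>x. x \<in> I \<Longrightarrow> H x x = 1"
    "\<And>x y. x \<in> I \<Longrightarrow> y \<in> I \<Longrightarrow> H x y = H y x"
    "\<And>x y. x \<in> I \<Longrightarrow> y \<in> I \<Longrightarrow> H x y \<in> {1, - 1}"
    "\<And>x y. x \<in> I \<Longrightarrow> y \<in> I \<Longrightarrow> (\<Sum>z\<in>I. H x z * H z y) = (if x = y then (real s)\<^sup>2 else 0)"
  using assms unfolding hadamard_on_def by blast+

text \<open>
  Fixing the index type to the natural numbers allows products of arbitrarily many such matrices to be formed
  by induction.
\<close>

definition graphical_hadamard :: "nat \<Rightarrow> bool" where
  "graphical_hadamard s \<longleftrightarrow> (\<exists>(I :: nat set) H. hadamard_on I H s)"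

lemma graphical_hadamardI:
  fixes I :: "'a :: countable set"
  assumes "hadamard_on I H s"
  shows "graphical_hadamard s"
proof -
  note H = hadamard_onD[OF assms]
  let ?H = "\<lambda>x y. H (from_nat x) (from_nat y)"
  have "hadamard_on (to_nat ` I) ?H s"
  proof (rule hadamard_onI)
    show "card (to_nat ` I) = s\<^sup>2"
      using H(2) by (simp add: card_image)
    show "(\<Sum>z\<in>to_nat ` I. ?H x z * ?H z y) = (if x = y then (real s)\<^sup>2 else 0)"
      if xy: "x \<in> to_nat ` I" "y \<in> to_nat ` I" for x y
    proof -
      obtain a b where ab: "a \<in> I" "b \<in> I" "x = to_nat a" "y = to_nat b"
        using xy by blast
      have "(\<Sum>z\<in>to_nat ` I. ?H x z * ?H z y) = (\<Sum>z\<in>I. H a z * H z b)"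
        by (simp add: sum.reindex ab)
      then show ?thesis
        using H(6)[OF ab(1,2)] by (simp add: ab)
    qed
    show "?H x y = ?H y x" if "x \<in> to_nat ` I" "y \<in> to_nat ` I" for x y
      using H(4) that by fastforce
    show "?H x y \<in> {1, - 1}" if "x \<in> to_nat ` I" "y \<in> to_nat ` I" for x y
      using H(5) that by fastforce
  qed (use H(1,3) in auto)
  then show ?thesis
    unfolding graphical_hadamard_def by blast
qed

text \<open>
  Symmetry, the diagonal, the entries and the orthogonality of the rows all pass to the Kronecker product.
\<close>

lemma graphical_hadamard_mult:
  assumes "graphical_hadamard s" "graphical_hadamard t"
  shows "graphical_hadamard (s * t)"
proof -
  obtain I J :: "nat set" and H K where "hadamard_on I H s" "hadamard_on J K t"
    using assms by (auto simp: graphical_hadamard_def)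
  note H = hadamard_onD[OF this(1)] and K = hadamard_onD[OF this(2)]
  let ?T = "\<lambda>x y. H (fst x) (fst y) * K (snd x) (snd y)"
  have "hadamard_on (I \<times> J) ?T (s * t)"
  proof (rule hadamard_onI)
    show "(\<Sum>z\<in>I \<times> J. ?T x z * ?T z y) = (if x = y then (real (s * t))\<^sup>2 else 0)"
      if xy: "x \<in> I \<times> J" "y \<in> I \<times> J" for x y
    proof -
      have I: "fst x \<in> I" "fst y \<in> I" and J: "snd x \<in> J" "snd y \<in> J"
        using xy by auto
      have "(\<Sum>z\<in>I \<times> J. ?T x z * ?T z y)
          = (\<Sum>z\<in>I. H (fst x) z * H z (fst y)) * (\<Sum>z\<in>J. K (snd x) z * K z (snd y))"
        by (simp add: sum_product sum.cartesian_product case_prod_beta mult_ac)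
      then show ?thesis
        unfolding H(6)[OF I] K(6)[OF J] by (auto simp: prod_eq_iff power_mult_distrib)
    qed
    show "?T x y = ?T y x" if "x \<in> I \<times> J" "y \<in> I \<times> J" for x y
      using H(4)[of "fst x" "fst y"] K(4)[of "snd x" "snd y"] that by auto
    show "?T x y \<in> {1, - 1}" if "x \<in> I \<times> J" "y \<in> I \<times> J" for x y
      using H(5)[of "fst x" "fst y"] K(5)[of "snd x" "snd y"] that by auto
  qed (use H(1-3) K(1-3) in \<open>auto simp: card_cartesian_product power_mult_distrib\<close>)
  then show ?thesis
    by (rule graphical_hadamardI)
qed

text \<open>
  With \<open>m = 2g\<close> the matrix is \<open>H = J - 2S + m I\<close>: on the diagonal the \<open>g\<close> common lines of a point with itself are
  compensated by \<open>m I\<close>, and off the diagonal the sign records whether the points share a line. From the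
  formula for \<open>S\<^sup>2\<close> and \<open>S J = J S = g m J\<close>, the square of \<open>H\<close> is \<open>m\<^sup>2 I\<close> plus
  \<open>m\<^sup>2 - 4gm + 2m + 4g(g - 1)\<close> times \<open>J\<close>, and the last coefficient is zero for \<open>m = 2g\<close>.
\<close>

lemma graphical_hadamard_latin_square:
  assumes g: "1 \<le> g" "g \<le> 3"
  shows "graphical_hadamard (2 * g)"
proof -
  define m where "m = 2 * g"
  let ?I = "grid m" and ?S = "common_lines g m"
  define H where "H x y = 1 - 2 * ?S x y + m * of_bool (x = y)" for x y
  have "(\<Sum>z\<in>?I. H x z * H z y) = (if x = y then (real m)\<^sup>2 else 0)" if "x \<in> ?I" "y \<in> ?I" for x y
  proof -
    have SS: "(\<Sum>z\<in>?I. ?S x z * ?S z y) = m * ?S x y + g * (real g - 1)"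
      by (rule sum_common_lines_mult[OF g(2) that])
    have S1: "(\<Sum>z\<in>?I. ?S x z) = g * m" "(\<Sum>z\<in>?I. ?S z y) = g * m"
      using sum_common_lines[OF g(2)] that by (simp_all add: common_lines_commute[of g m _ y])
    have "(\<Sum>z\<in>?I. H x z * H z y)
        = (\<Sum>z\<in>?I. 1 - 2 * ?S x z - 2 * ?S z y + 4 * (?S x z * ?S z y)
            + (if x = z then m * H z y else 0) + (if z = y then m * (1 - 2 * ?S x z) else 0))"
      unfolding H_def by (intro sum.cong) (auto simp: algebra_simps)
    also have "\<dots> = real (m * m) - 2 * (g * m) - 2 * (g * m) + 4 * (m * ?S x y + g * (real g - 1))
        + m * H x y + m * (1 - 2 * ?S x y)"
      using that by (simp add: sum.distrib sum_subtractf S1 SS card_cartesian_product flip: sum_distrib_left)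
    also have "\<dots> = (if x = y then (real m)\<^sup>2 else 0)"
      by (simp add: H_def m_def algebra_simps power2_eq_square)
    finally show ?thesis .
  qed
  moreover have "H x y \<in> {1, - 1}" if "x \<in> ?I" "y \<in> ?I" for x y
    using common_lines_01[OF g(2) that] by (cases "x = y") (auto simp: H_def common_lines_self m_def)
  moreover have "H x y = H y x" for x y
    by (simp add: H_def common_lines_commute[of g m x] eq_commute[of x])
  moreover have "H x x = 1" for x
    by (simp add: H_def common_lines_self m_def)
  ultimately have "hadamard_on ?I H m"
    by (intro hadamard_onI) (simp_all add: card_cartesian_product power2_eq_square)
  then show ?thesis
    unfolding m_def by (rule graphical_hadamardI)
qed

lemma graphical_hadamard_power_two: "graphical_hadamard (2 ^ a)"
proof (induction a)
  case 0
  have "hadamard_on {0 :: nat} (\<lambda>_ _. 1) 1"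
    by (simp add: hadamard_on_def)
  then show ?case
    by (auto intro: graphical_hadamardI)
next
  case (Suc a)
  then show ?case
    using graphical_hadamard_mult[OF graphical_hadamard_latin_square[of 1]] by simp
qed

text \<open>
  Because \<open>H\<^sup>2 = s\<^sup>2 I\<close>, the projection onto the eigenspace for \<open>s\<close> is \<open>P = (H + s I)/(2s)\<close>, of trace
  \<open>s(s + 1)/2\<close>. On this eigenspace the form of \<open>A = (J + H)/2\<close> is \<open>s/2\<close> times the squared norm plus half the
  square of the sum of the entries.
\<close>

lemma graphical_hadamard_pattern:
  assumes "graphical_hadamard s" "0 < s"
  shows "spectral_pattern (s * s) (s * (s + 1) div 2) (real s / 2)"
proof -
  obtain I :: "nat set" and H where had: "hadamard_on I H s"
    using assms(1) by (auto simp: graphical_hadamard_def)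
  note I = hadamard_onD(1,2)[OF had] and H1 = hadamard_onD(3)[OF had]
    and sym = hadamard_onD(4)[OF had] and pm = hadamard_onD(5)[OF had] and HH = hadamard_onD(6)[OF had]
  define A where "A x y = (1 + H x y) / 2" for x y
  define P where "P x y = (H x y + s * of_bool (x = y)) / (2 * s)" for x y
  have "spectral_pattern (card I) (s * (s + 1) div 2) (real s / 2)"
  proof (rule spectral_pattern_projection[where A = A and P = P])
    show "(\<Sum>z\<in>I. P x z * P z y) = P x y" if "x \<in> I" "y \<in> I" for x y
    proof -
      have "(\<Sum>z\<in>I. P x z * P z y) = (\<Sum>z\<in>I. H x z * H z y
          + (if x = z then s * (H z y + s * of_bool (z = y)) else 0)
          + (if z = y then s * H x z else 0)) / (2 * s)\<^sup>2"
        unfolding sum_divide_distrib P_def by (intro sum.cong) (auto simp: algebra_simps power2_eq_square add_divide_distrib)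
      also have "\<dots> = ((if x = y then (real s)\<^sup>2 else 0) + s * (H x y + s * of_bool (x = y)) + s * H x y)
          / (2 * s)\<^sup>2"
        using that I(1) by (simp add: sum.distrib HH)
      also have "\<dots> = P x y"
        using assms(2) by (simp add: P_def field_simps power2_eq_square)
      finally show ?thesis .
    qed
    have "even (s * (s + 1))" by simp
    then have "real (s * (s + 1) div 2) = real (s * (s + 1)) / 2"
      by (simp add: real_of_nat_div)
    then show "(\<Sum>x\<in>I. P x x) = real (s * (s + 1) div 2)"
      using assms(2) I by (simp add: P_def H1 field_simps power2_eq_square)
    show "real s / 2 * (\<Sum>i\<in>I. (x i)\<^sup>2) \<le> (\<Sum>i\<in>I. \<Sum>j\<in>I. A i j * x i * x j)"
      if x: "\<And>i. i \<in> I \<Longrightarrow> (\<Sum>j\<in>I. P i j * x j) = x i" for x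
    proof -
      define t where "t = (\<Sum>j\<in>I. x j)"
      have Ax: "(\<Sum>j\<in>I. A i j * x j) = t / 2 + real s / 2 * x i" if "i \<in> I" for i
      proof -
        have "(\<Sum>j\<in>I. A i j * x j)
            = (\<Sum>j\<in>I. x j / 2 + s * (P i j * x j) - (if i = j then real s / 2 * x j else 0))"
          using assms(2) by (intro sum.cong) (auto simp: A_def P_def field_simps)
        also have "\<dots> = t / 2 + s * x i - real s / 2 * x i"
          using that I(1)
          by (simp add: sum.distrib sum_subtractf t_def x flip: sum_distrib_left sum_divide_distrib)
        finally show ?thesis
          by (simp add: algebra_simps)
      qed
      have "(\<Sum>i\<in>I. \<Sum>j\<in>I. A i j * x i * x j) = (\<Sum>i\<in>I. x i * (\<Sum>j\<in>I. A i j * x j))"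
        by (simp add: sum_distrib_left mult_ac)
      also have "\<dots> = (\<Sum>i\<in>I. t / 2 * x i + real s / 2 * (x i)\<^sup>2)"
        by (intro sum.cong refl) (simp only: Ax, simp add: algebra_simps power2_eq_square)
      also have "\<dots> = t\<^sup>2 / 2 + real s / 2 * (\<Sum>i\<in>I. (x i)\<^sup>2)"
        by (simp only: sum.distrib sum_distrib_left[symmetric] t_def[symmetric] power2_eq_square)
      finally show ?thesis by simp
    qed
    show "A x y = A y x \<and> A x y \<in> {0, 1}" if "x \<in> I" "y \<in> I" for x y
      using sym[OF that] pm[OF that] by (auto simp: A_def)
    show "P x y = P y x" if "x \<in> I" "y \<in> I" for x y
      using sym[OF that] by (simp add: P_def eq_commute[of x])
  qed (use I H1 in \<open>auto simp: A_def\<close>)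
  then show ?thesis
    by (simp add: I power2_eq_square)
qed

section \<open>Choice of the pattern for each index\<close>

lemma eigenvalue_consts_ge:
  assumes "spectral_pattern n k \<beta>" "2 \<le> k"
  shows "\<beta> / n \<le> eigenvalue_const (int k) \<and> \<beta> / n \<le> eigenvalue_const (- int k + 1)"
proof -
  have "spectral_pattern n (Suc (k - 1)) \<beta>"
    using assms by simp
  then have "\<beta> / n \<le> eigenvalue_const (- int (k - 1))"
    using assms(2) by (intro spectral_pattern_smallest) auto
  moreover have "- int (k - 1) = - int k + 1"
    using assms(2) by (simp add: of_nat_diff)
  ultimately show ?thesis
    using spectral_pattern_largest[OF assms(1)] assms(2) by simp
qed

text \<open>
  A number \<open>s\<close> serves \<open>s\<^sup>2/4 + 1 \<le> k \<le> s(s + 1)/2\<close>, so its range and that of a larger \<open>s'\<close> leave no gap if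
  \<open>s'\<^sup>2 \<le> 2s(s + 1)\<close>. This holds for the steps in \<open>6, 8, 12, 16\<close> and, for \<open>u\<close> a power of two, in
  \<open>24u, 32u, 36u, 48u\<close>. Only the step from 16 to 24 is too large: 16 serves up to 136 and 24 from 145 on.
\<close>

lemma hadamard_order_selection:
  fixes k :: nat
  assumes "16 \<le> k" "k \<notin> {137..144}"
  shows "\<exists>s>0. graphical_hadamard s \<and> s * s \<le> 4 * (k - 1) \<and> k \<le> s * (s + 1) div 2"
proof -
  have six: "graphical_hadamard 6"
    using graphical_hadamard_latin_square[of 3] by simp
  have six_two: "graphical_hadamard (6 * 2 ^ a)" for a
    by (rule graphical_hadamard_mult[OF six graphical_hadamard_power_two])
  show ?thesis
  proof (cases "k \<le> 136")
    case True
    consider "k \<le> 21" | "22 \<le> k" "k \<le> 36" | "37 \<le> k" "k \<le> 78" | "79 \<le> k" "k \<le> 136"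
      using True by linarith
    then show ?thesis
    proof cases
      case 1
      then show ?thesis
        using six assms(1) by (intro exI[of _ 6]) auto
    next
      case 2
      then show ?thesis
        using graphical_hadamard_power_two[of 3] by (intro exI[of _ 8]) auto
    next
      case 3
      then show ?thesis
        using six_two[of 1] by (intro exI[of _ 12]) auto
    next
      case 4
      then show ?thesis
        using graphical_hadamard_power_two[of 4] by (intro exI[of _ 16]) auto
    qed
  next
    case False
    then have "145 \<le> k"
      using assms(2) by auto
    \<comment> \<open>Choose \<open>u = 2 ^ a\<close> maximal with \<open>(24 u)\<^sup>2 \<le> 4 (k - 1)\<close>; then \<open>4 (k - 1) < (48 u)\<^sup>2\<close>.\<close>
    have "\<exists>a. 576 * (2 ^ a)\<^sup>2 \<le> 4 * (k - 1) \<and> 4 * (k - 1) < 2304 * (2 ^ a :: nat)\<^sup>2"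
    proof -
      let ?Q = "\<lambda>a. 4 * (k - 1) < 576 * (2 ^ a :: nat)\<^sup>2"
      have "k < 2 ^ k"
        by (rule less_exp)
      also have "(2 :: nat) ^ k \<le> (2 ^ k)\<^sup>2"
        by (simp add: power2_eq_square)
      finally have "?Q k"
        by simp
      then have ex: "?Q (LEAST a. ?Q a)"
        by (rule LeastI)
      have "(LEAST a. ?Q a) \<noteq> 0"
        using ex \<open>145 \<le> k\<close> by (intro notI) simp
      then obtain a where a: "(LEAST a. ?Q a) = Suc a"
        by (cases "LEAST a. ?Q a") auto
      then have "\<not> ?Q a"
        by (metis lessI not_less_Least)
      then show ?thesis
        using ex unfolding a by (intro exI[of _ a]) (simp add: power2_eq_square)
    qed
    then obtain a where a: "576 * (2 ^ a)\<^sup>2 \<le> 4 * (k - 1)" "4 * (k - 1) < 2304 * (2 ^ a :: nat)\<^sup>2"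
      by blast
    define u :: nat where "u = 2 ^ a"
    have u: "0 < u" "576 * (u * u) \<le> 4 * (k - 1)" "4 * (k - 1) < 2304 * (u * u)"
      using a by (simp_all add: u_def power2_eq_square)
    \<comment> \<open>\<open>24 = 6 * 2\<^sup>2\<close>, \<open>32 = 2\<^sup>5\<close>, \<open>36 = 6 * 6\<close>\<close>
    have gh: "graphical_hadamard (24 * u)" "graphical_hadamard (32 * u)" "graphical_hadamard (36 * u)"
      using six_two[of "a + 2"] graphical_hadamard_power_two[of "a + 5"]
        graphical_hadamard_mult[OF six six_two[of a]] by (simp_all add: u_def power_add mult.commute)
    have half: "k \<le> s * (s + 1) div 2 \<longleftrightarrow> 2 * k \<le> s * s + s" for s
      by (simp add: less_eq_div_iff_mult_less_eq ac_simps)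
    consider "2 * k \<le> 576 * (u * u) + 24 * u"
      | "576 * (u * u) + 24 * u < 2 * k" "2 * k \<le> 1024 * (u * u) + 32 * u"
      | "1024 * (u * u) + 32 * u < 2 * k"
      by linarith
    then obtain s where "s \<in> {24 * u, 32 * u, 36 * u}" "s * s \<le> 4 * (k - 1)" "2 * k \<le> s * s + s"
    proof cases
      case 1
      then show thesis
        using that[of "24 * u"] u by simp
    next
      case 2
      then have "1024 * (u * u) \<le> 4 * (k - 1)"
        using u(1) by linarith
      then show thesis
        using that[of "32 * u"] 2 by simp
    next
      case 3
      then have "1296 * (u * u) \<le> 4 * (k - 1)"
        using u(1) by linarith
      moreover have "2 * k \<le> 1296 * (u * u) + 36 * u"
        using u by linarith
      ultimately show thesis
        using that[of "36 * u"] by simp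
    qed
    moreover from this(1) have "0 < s" "graphical_hadamard s"
      using u(1) gh by auto
    ultimately show ?thesis
      unfolding half by blast
  qed
qed

theorem theorem2p10:
  fixes k :: int
  shows "(5 \<le> k \<and> k \<le> 15 \<longrightarrow>
            eigenvalue_const k \<ge> 1 / (real_of_int k - 1 / 2) \<and>
            eigenvalue_const (- k + 1) \<ge> 1 / (real_of_int k - 1 / 2)) \<and>
         (k \<ge> 16 \<longrightarrow>
            eigenvalue_const k \<ge> 1 / (4 * sqrt (real_of_int k - 1)) \<and>
            eigenvalue_const (- k + 1) \<ge> 1 / (4 * sqrt (real_of_int k - 1)))"
proof (intro conjI[of "_ \<longrightarrow> _" "_ \<longrightarrow> _"] impI)
  assume k: "5 \<le> k \<and> k \<le> 15"
  define j where "j = nat (k - 5)"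
  have j: "k = int (5 + j)"
    using k by (simp add: j_def)
  \<comment> \<open>Rows and columns of the \<open>3 \<times> 3\<close> grid: \<open>g = 2\<close> and \<open>m = 3\<close>.\<close>
  have "spectral_pattern 9 5 (real 2)"
    using latin_square_pattern[of 2 3] by simp
  then have "spectral_pattern (9 + j * 2) (5 + j) (real 2)"
    by (rule spectral_pattern_add_cliques) simp
  from eigenvalue_consts_ge[OF this] show "eigenvalue_const k \<ge> 1 / (real_of_int k - 1 / 2) \<and>
      eigenvalue_const (- k + 1) \<ge> 1 / (real_of_int k - 1 / 2)"
    unfolding j by (simp add: field_simps)
next
  assume k: "16 \<le> k"
  define j where "j = nat k"
  have j: "k = int j" "16 \<le> j"
    using k by (simp_all add: j_def)
  have sq: "sqrt (real_of_int k - 1) > 0"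
    using k by simp
  have "\<exists>n \<beta>. spectral_pattern n j \<beta> \<and> 1 / (4 * sqrt (real_of_int k - 1)) \<le> \<beta> / n"
  proof (cases "j \<in> {137..144}")
    case True
    define i where "i = j - 136"
    have i: "j = 136 + i" "1 \<le> i" "i \<le> 8"
      using True by (auto simp: i_def)
    \<comment> \<open>The gap between 16 and 24: with \<open>i\<close> cliques on 8 vertices, \<open>n/\<beta> = 32 + i \<le> 40\<close>, and \<open>4 sqrt(k - 1) \<ge> 40\<close>.\<close>
    have "spectral_pattern 256 136 (real 8)"
      using graphical_hadamard_pattern[OF graphical_hadamard_power_two[of 4]] by simp
    then have "spectral_pattern (256 + i * 8) (136 + i) (real 8)"
      by (rule spectral_pattern_add_cliques) simp
    moreover have "1 / (4 * sqrt (real_of_int k - 1)) \<le> real 8 / real (256 + i * 8)"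
    proof -
      have "10 \<le> sqrt (real_of_int k - 1)"
        by (rule real_le_rsqrt) (use i j in simp)
      then have "1 / (4 * sqrt (real_of_int k - 1)) \<le> 1 / 40"
        using sq by (intro divide_left_mono) auto
      also have "\<dots> \<le> real 8 / real (256 + i * 8)"
        using i by (simp add: field_simps)
      finally show ?thesis .
    qed
    ultimately show ?thesis
      unfolding i(1) by blast
  next
    case False
    then obtain s where s: "0 < s" "graphical_hadamard s" "s * s \<le> 4 * (j - 1)" "j \<le> s * (s + 1) div 2"
      using hadamard_order_selection[OF j(2)] by blast
    have "spectral_pattern (s * s) j (real s / 2)"
      using spectral_pattern_mono[OF graphical_hadamard_pattern[OF s(2,1)] s(4)] .
    moreover have "1 / (4 * sqrt (real_of_int k - 1)) \<le> (real s / 2) / real (s * s)"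
    proof -
      have "real (s * s) \<le> real (4 * (j - 1))"
        using s(3) by (rule of_nat_mono)
      then have "(real s / 2)\<^sup>2 \<le> real_of_int k - 1"
        using j by (simp add: of_nat_diff power2_eq_square)
      then have "real s / 2 \<le> sqrt (real_of_int k - 1)"
        by (rule real_le_rsqrt)
      then have "1 / (4 * sqrt (real_of_int k - 1)) \<le> 1 / (4 * (real s / 2))"
        using s(1) sq by (intro divide_left_mono mult_left_mono mult_pos_pos) auto
      also have "\<dots> = (real s / 2) / real (s * s)"
        using s(1) by (simp add: field_simps)
      finally show ?thesis .
    qed
    ultimately show ?thesis by blast
  qed
  then show "eigenvalue_const k \<ge> 1 / (4 * sqrt (real_of_int k - 1)) \<and>
      eigenvalue_const (- k + 1) \<ge> 1 / (4 * sqrt (real_of_int k - 1))"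
    using eigenvalue_consts_ge[of _ j] j by fastforce
qed

end
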